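(* Let $V^-,V^+:\mathbb{N}^d\to\mathbb{R}$ be given and let $\mathcal{L}$ be the generator on $\mathbb{N}^d$ with moves $\gamma_i^{\pm}$ and rates $$c(\eta,\gamma_i^+)=\exp(-\nabla_i^+V^+(\eta)),\qquad c(\eta,\gamma_i^-)=\exp(-\nabla_i^-V^-(\eta))\,\mathbf 1_{\{\eta_i>0\}}.$$ Assume that properties (Irr) and (Rev) hold and that $$\inf_{\eta\in\mathbb{N}^d,\,i\le d}\nabla_i^+V^+(\eta)>-\infty,\qquad \inf\{\nabla_i^-V^-(\eta):\eta\in\mathbb N^d,\ \eta_i\le K\}>-\infty\quad\forall K>0,\ i\le d.$$ Then for any $\kappa>0$ the following statements are equivalent: (i) The estimate $W_p(\mu_t,\nu_t)\le\exp(-\frac{\kappa}{p}t)\,W_p(\mu,\nu)$ holds for all $p\ge1$, all $\mu,\nu\in\mathcal P_p(\mathbb{N}^d)$ and all $t>0$. (ii) $\kappa^+(\eta,i)\ge0$ and $\kappa^-(\eta,i)\ge0$ for all $\eta\in\mathbb{N}^d$, $i\le d$, and $$\inf_{\eta\in\mathbb{N}^d,\,i\le d}\big(\kappa^+(\eta,i)+\kappa^-(\eta,i)\big)\ge\kappa,$$ where $$\kappa^+(\eta,i)=-\nabla_i^+c(\eta,\gamma_i^+)-\sum_{\gamma\in G\setminus\{\gamma_i^+,\gamma_i^-\}}\max\{\nabla_i^+c(\eta,\gamma),0\},$$ $$\kappa^-(\eta,i)=\nabla_i^+c(\eta,\gamma_i^-)-\sum_{\gamma\in G\setminus\{\ga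mma_i^+,\gamma_i^-\}}\max\{-\nabla_i^+c(\eta,\gamma),0\}.$$
   Context: Setting: $d\ge1$, $\mathbb{N}=\{0,1,2,\dots\}$, $\Omega=\mathbb{N}^d$ with canonical basis $(\mathbf e_i)_{i\le d}$. The set of moves is $G=\{\gamma_i^+,\gamma_i^-:1\le i\le d\}$, with $\gamma_i^+\eta=\eta+\mathbf e_i$ and $\gamma_i^-\eta=\eta-\mathbf e_i\mathbf 1_{\{\eta_i>0\}}$. For a function $F$ on $\mathbb{N}^d$, $\nabla_i^{\pm}F(\eta)=F(\gamma_i^{\pm}\eta)-F(\eta)$; $\nabla_i^+c(\eta,\gamma)=c(\gamma_i^+\eta,\gamma)-c(\eta,\gamma)$ for $\gamma\in G$. Given rates $c:\Omega\times G\to[0,\infty)$, $\mathcal{L}f(\eta)=\sum_{i=1}^d c(\eta,\gamma_i^+)\nabla_i^+f(\eta)+c(\eta,\gamma_i^-)\nabla_i^-f(\eta)$. (Irr): $\mathcal L$ is irreducible and admits an invariant probability measure $\mathbf m$ with $\sum_{\eta\in\Omega,\sigma\in G}c(\eta,\sigma)\mathbf m(\eta)<\infty$ (the associated continuous time Markov chain is then non-explosive). (Rev): with the involution $(\gamma_i^{\pm})^{-1}:=\gamma_i^{\mp}$ of $G$ one has $\sigma^{-1}(\sigma\eta)=\eta$ whenever $\mathbf m(\eta)c(\eta,\sigma)>0$, and $\sum_{\eta,\sigma}F(\eta,\sigma)c(\eta,\sigma)\mathbf m(\eta)=\sum_{\eta,\sigma}F(\sigma\eta,\sigma^{-1})c(\eta,\sigma)\mathbf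 m(\eta)$ for all bounded $F:\Omega\times G\to\mathbb R$. Distance: $d(\eta,\bar\eta)=\sum_{i=1}^d|\eta_i-\bar\eta_i|$. $\mathcal P_p(\mathbb{N}^d)$ is the set of probability measures on $\mathbb N^d$ with finite $p$-th moment, and $W_p(\mu,\nu)=\big(\inf_{\pi\in\Pi(\mu,\nu)}\sum_{\eta',\eta''}d(\eta',\eta'')^p\pi(\eta',\eta'')\big)^{1/p}$, with $\Pi(\mu,\nu)$ the set of couplings of $\mu$ and $\nu$. For an initial law $\mu$, $\mu_t$ denotes the law at time $t$ of the continuous time Markov chain with generator $\mathcal L$ and initial distribution $\mu$ (likewise $\nu_t$). *)

theory Defs
  imports "HOL-Probability.Probability"
begin

section \<open>State space, moves and discrete gradients\<close>

type_synonym 'd state = "nat ^ 'd"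

text \<open>\<open>Inc i\<close> and \<open>Dec i\<close> are the moves \<open>\<gamma>\<^sub>i\<^sup>+\<close> and \<open>\<gamma>\<^sub>i\<^sup>-\<close>.\<close>

datatype 'd move = Inc 'd | Dec 'd

lemma UNIV_move: "UNIV = range Inc \<union> range Dec"
proof -
  have "x \<in> range Inc \<union> range Dec" for x :: "'a move"
    by (cases x) auto
  then show ?thesis by blast
qed

instance move :: (finite) finite
  by standard (simp add: UNIV_move)

fun inv_move :: "'d move \<Rightarrow> 'd move" where
  "inv_move (Inc i) = Dec i"
| "inv_move (Dec i) = Inc i"

fun act :: "'d::finite move \<Rightarrow> 'd state \<Rightarrow> 'd state" where
  "act (Inc i) \<eta> = \<eta> + axis i 1"
| "act (Dec i) \<eta> = (if \<eta> $ i > 0 then \<eta> - axis i 1 else \<eta>)"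

definition grad :: "'d::finite move \<Rightarrow> ('d state \<Rightarrow> real) \<Rightarrow> 'd state \<Rightarrow> real" where
  "grad \<sigma> F \<eta> = F (act \<sigma> \<eta>) - F \<eta>"

section \<open>The continuous time Markov chain\<close>

type_synonym 'd rates = "'d state \<Rightarrow> 'd move \<Rightarrow> real"

definition generator :: "'d::finite rates \<Rightarrow> ('d state \<Rightarrow> real) \<Rightarrow> 'd state \<Rightarrow> real" where
  "generator c f \<eta> =
     (\<Sum>i\<in>UNIV. c \<eta> (Inc i) * grad (Inc i) f \<eta> + c \<eta> (Dec i) * grad (Dec i) f \<eta>)"

definition total_rate :: "'d::finite rates \<Rightarrow> 'd state \<Rightarrow> real" where
  "total_rate c \<eta> = (\<Sum>\<sigma>\<in>UNIV. c \<eta> \<sigma>)"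

text \<open>
  The chain with generator \<open>generator c\<close> waits in \<open>\<eta>\<close> for an exponential time of parameter
  \<open>total_rate c \<eta>\<close> and then performs the move \<open>\<sigma>\<close> with probability proportional to
  \<open>c \<eta> \<sigma>\<close>.  By decomposition at the first jump, \<open>trans_upto c n t \<eta> \<eta>'\<close> is the probability
  that the chain started in \<open>\<eta>\<close> is in \<open>\<eta>'\<close> at time \<open>t \<ge> 0\<close> and has made fewer than \<open>n\<close>
  jumps by then.  A move of positive rate that fixes \<open>\<eta>\<close> counts as a jump; this does not affect
  the law of the chain.  The supremum over \<open>n\<close> is the transition function of the minimal
  (Feller) chain; it solves the backward equation of \<open>generator c\<close>, lemma
  \<open>backward_equation\<close> below, and total mass less than 1 means explosion.
\<close>

primrec trans_upto ::
    "'d::finite rates \<Rightarrow> nat \<Rightarrow> real \<Rightarrow> 'd state \<Rightarrow> 'd state \<Rightarrow> ennreal" where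
  "trans_upto c 0 = (\<lambda>t \<eta> \<eta>'. 0)"
| "trans_upto c (Suc n) = (\<lambda>t \<eta> \<eta>'.
     ennreal (exp (- total_rate c \<eta> * t)) * indicator {\<eta>} \<eta>' +
     (\<integral>\<^sup>+ s\<in>{0..t}. (\<Sum>\<sigma>\<in>UNIV. ennreal (exp (- total_rate c \<eta> * s) * c \<eta> \<sigma>) *
        trans_upto c n (t - s) (act \<sigma> \<eta>) \<eta>') \<partial>lborel))"

definition transition :: "'d::finite rates \<Rightarrow> real \<Rightarrow> 'd state \<Rightarrow> 'd state \<Rightarrow> ennreal" where
  "transition c t \<eta> \<eta>' = (SUP n. trans_upto c n t \<eta> \<eta>')"

definition law_mass :: "'d::finite rates \<Rightarrow> 'd state pmf \<Rightarrow> real \<Rightarrow> 'd state \<Rightarrow> ennreal" where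
  "law_mass c \<mu> t \<eta>' = (\<integral>\<^sup>+ \<eta>. transition c t \<eta> \<eta>' \<partial>measure_pmf \<mu>)"

text \<open>
  The law \<open>\<mu>\<^sub>t\<close>.  It is meaningful only if \<open>law_mass c \<mu> t\<close> has total mass 1, which
  lemma \<open>law_mass_total_1\<close> below derives from \<open>property_Irr\<close>.
\<close>

definition law_at :: "'d::finite rates \<Rightarrow> 'd state pmf \<Rightarrow> real \<Rightarrow> 'd state pmf" where
  "law_at c \<mu> t = embed_pmf (\<lambda>\<eta>'. enn2real (law_mass c \<mu> t \<eta>'))"

definition irreducible_rates :: "'d::finite rates \<Rightarrow> bool" where
  "irreducible_rates c \<longleftrightarrow> (\<forall>\<eta> \<eta>'. (\<eta>, \<eta>') \<in> {(\<xi>, act \<sigma> \<xi>) | \<xi> \<sigma>. c \<xi> \<sigma> > 0}\<^sup>*)"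

definition invariant_law :: "'d::finite rates \<Rightarrow> 'd state pmf \<Rightarrow> bool" where
  "invariant_law c m \<longleftrightarrow> (\<forall>t\<ge>0. \<forall>\<eta>. law_mass c m t \<eta> = ennreal (pmf m \<eta>))"

definition property_Irr :: "'d::finite rates \<Rightarrow> 'd state pmf \<Rightarrow> bool" where
  "property_Irr c m \<longleftrightarrow> irreducible_rates c \<and> invariant_law c m \<and>
     (\<lambda>(\<eta>, \<sigma>). c \<eta> \<sigma> * pmf m \<eta>) summable_on UNIV"

definition property_Rev :: "'d::finite rates \<Rightarrow> 'd state pmf \<Rightarrow> bool" where
  "property_Rev c m \<longleftrightarrow>
     (\<forall>\<eta> \<sigma>. pmf m \<eta> * c \<eta> \<sigma> > 0 \<longrightarrow> act (inv_move \<sigma>) (act \<sigma> \<eta>) = \<eta>) \<and>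
     (\<forall>F :: 'd state \<times> 'd move \<Rightarrow> real. bounded (range F) \<longrightarrow>
        (\<Sum>\<^sub>\<infinity>(\<eta>, \<sigma>)\<in>UNIV. F (\<eta>, \<sigma>) * c \<eta> \<sigma> * pmf m \<eta>) =
        (\<Sum>\<^sub>\<infinity>(\<eta>, \<sigma>)\<in>UNIV. F (act \<sigma> \<eta>, inv_move \<sigma>) * c \<eta> \<sigma> * pmf m \<eta>))"

section \<open>Non-explosion and the backward equation\<close>

lemma measurable_trans_upto [measurable]:
  "(\<lambda>t. trans_upto c n t x y) \<in> borel_measurable borel"
proof (induction n arbitrary: x)
  case 0 show ?case by simp
next
  case (Suc n)
  note [measurable] = Suc
  show ?case unfolding trans_upto.simps atLeastAtMost_iff indicator_def
    by measurable
qed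

lemma trans_upto_mono: "trans_upto c n t x y \<le> trans_upto c (Suc n) t x y"
proof (induction n arbitrary: t x)
  case 0 show ?case by simp
next
  case (Suc n)
  show ?case
    by (subst (1 2) trans_upto.simps(2))
       (intro add_mono nn_integral_mono mult_right_mono sum_mono mult_left_mono Suc order_refl zero_le)
qed

lemma incseq_trans_upto: "incseq (\<lambda>n. trans_upto c n t x y)"
  by (intro incseq_SucI trans_upto_mono)

lemma measurable_transition [measurable]:
  "(\<lambda>t. transition c t x y) \<in> borel_measurable borel"
  unfolding transition_def by measurable

lemma total_rate_nonneg: "(\<And>x \<sigma>. 0 \<le> c x \<sigma>) \<Longrightarrow> 0 \<le> total_rate c x"
  by (simp add: total_rate_def sum_nonneg)

lemma trans_upto_mass:
  fixes c :: "'d::finite rates"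
  assumes c: "\<And>x \<sigma>. 0 \<le> c x \<sigma>" and t: "0 \<le> t"
  shows "(\<integral>\<^sup>+ y. trans_upto c n t x y \<partial>count_space UNIV) \<le> 1"
  using t
proof (induction n arbitrary: t x)
  case 0 then show ?case by simp
next
  case (Suc n)
  let ?q = "total_rate c x"
  have q: "0 \<le> ?q" by (rule total_rate_nonneg) (rule c)
  let ?w = "\<lambda>s \<sigma>. ennreal (exp (- ?q * s) * c x \<sigma>)"
  have "(\<integral>\<^sup>+ y. trans_upto c (Suc n) t x y \<partial>count_space UNIV) =
      (\<integral>\<^sup>+ y. ennreal (exp (- ?q * t)) * indicator {x} y \<partial>count_space UNIV) +
      (\<integral>\<^sup>+ y. (\<integral>\<^sup>+ s\<in>{0..t}. (\<Sum>\<sigma>\<in>UNIV. ?w s \<sigma> * trans_upto c n (t - s) (act \<sigma> x) y) \<partial>lborel)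
        \<partial>count_space UNIV)"
    by (simp only: trans_upto.simps) (subst nn_integral_add, auto)
  also have "(\<integral>\<^sup>+ y. ennreal (exp (- ?q * t)) * indicator {x} y \<partial>count_space UNIV) =
      ennreal (exp (- ?q * t))"
    by (simp add: nn_integral_cmult)
  also have "(\<integral>\<^sup>+ y. (\<integral>\<^sup>+ s\<in>{0..t}. (\<Sum>\<sigma>\<in>UNIV. ?w s \<sigma> * trans_upto c n (t - s) (act \<sigma> x) y) \<partial>lborel)
        \<partial>count_space UNIV) =
      (\<integral>\<^sup>+ s. (\<integral>\<^sup>+ y. (\<Sum>\<sigma>\<in>UNIV. ?w s \<sigma> * trans_upto c n (t - s) (act \<sigma> x) y) * indicator {0..t} s
        \<partial>count_space UNIV) \<partial>lborel)"
    by (rule nn_integral_count_space_nn_integral[symmetric]) (simp, measurable)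
  also have "\<dots> \<le> (\<integral>\<^sup>+ s. ennreal (exp (- ?q * s) * ?q) * indicator {0..t} s \<partial>lborel)"
  proof (rule nn_integral_mono)
    fix s :: real
    show "(\<integral>\<^sup>+ y. (\<Sum>\<sigma>\<in>UNIV. ?w s \<sigma> * trans_upto c n (t - s) (act \<sigma> x) y) * indicator {0..t} s
        \<partial>count_space UNIV) \<le> ennreal (exp (- ?q * s) * ?q) * indicator {0..t} s"
    proof (cases "s \<in> {0..t}")
      case True
      have "(\<integral>\<^sup>+ y. (\<Sum>\<sigma>\<in>UNIV. ?w s \<sigma> * trans_upto c n (t - s) (act \<sigma> x) y) \<partial>count_space UNIV) =
          (\<Sum>\<sigma>\<in>UNIV. ?w s \<sigma> * (\<integral>\<^sup>+ y. trans_upto c n (t - s) (act \<sigma> x) y \<partial>count_space UNIV))"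
        by (subst nn_integral_sum) (auto simp: nn_integral_cmult)
      also have "\<dots> \<le> (\<Sum>\<sigma>\<in>UNIV. ?w s \<sigma> * 1)"
        using True by (intro sum_mono mult_left_mono Suc.IH) auto
      also have "\<dots> = ennreal (exp (- ?q * s) * ?q)"
        by (simp add: sum_ennreal c total_rate_def sum_distrib_left)
      finally show ?thesis using True by simp
    qed simp
  qed
  also have "\<dots> = ennreal (- exp (- ?q * t) - (- exp (- ?q * 0)))"
    using Suc.prems q by (intro nn_integral_FTC_Icc) (auto intro!: derivative_eq_intros)
  also have "ennreal (exp (- ?q * t)) + \<dots> = 1"
    using q Suc.prems by (subst ennreal_plus[symmetric]) auto
  finally show ?case by (simp add: add_left_mono)
qed

lemma transition_mass:
  fixes c :: "'d::finite rates"
  assumes c: "\<And>x \<sigma>. 0 \<le> c x \<sigma>" and t: "0 \<le> t"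
  shows "(\<integral>\<^sup>+ y. transition c t x y \<partial>count_space UNIV) \<le> 1"
  unfolding transition_def
  by (subst nn_integral_monotone_convergence_SUP)
     (auto simp: incseq_def le_fun_def intro!: SUP_least trans_upto_mass[OF c t]
        incseqD[OF incseq_trans_upto])

lemma transition_le_1:
  fixes c :: "'d::finite rates"
  assumes c: "\<And>x \<sigma>. 0 \<le> c x \<sigma>" and t: "0 \<le> t"
  shows "transition c t x y \<le> 1"
proof -
  have "transition c t x y = (\<integral>\<^sup>+ z. transition c t x y * indicator {y} z \<partial>count_space UNIV)"
    by (simp add: nn_integral_cmult)
  also have "\<dots> \<le> (\<integral>\<^sup>+ z. transition c t x z \<partial>count_space UNIV)"
    by (intro nn_integral_mono) (auto split: split_indicator)
  also have "\<dots> \<le> 1" by (rule transition_mass[OF c t])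
  finally show ?thesis .
qed

lemma trans_upto_pos:
  fixes c :: "'d::finite rates"
  assumes path: "(x, y) \<in> {(\<xi>, act \<sigma> \<xi>) | \<xi> \<sigma>. c \<xi> \<sigma> > 0}\<^sup>*"
  shows "\<exists>n. \<forall>t>0. trans_upto c n t x y > 0"
  using path
proof (induction rule: converse_rtrancl_induct)
  case base
  have "\<forall>t>0. trans_upto c (Suc 0) t y y > 0" by simp
  then show ?case by blast
next
  case (step x z)
  then obtain \<sigma> where \<sigma>: "z = act \<sigma> x" "c x \<sigma> > 0" by auto
  from step obtain n where n: "\<And>t. t > 0 \<Longrightarrow> trans_upto c n t z y > 0" by blast
  have "trans_upto c (Suc n) t x y > 0" if t: "t > 0" for t
  proof -
    let ?f = "\<lambda>s. (\<Sum>\<sigma>\<in>UNIV. ennreal (exp (- total_rate c x * s) * c x \<sigma>) *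
        trans_upto c n (t - s) (act \<sigma> x) y) * indicator {0..t} s"
    have fpos: "?f s \<noteq> 0" if s: "s \<in> {0<..<t}" for s
    proof -
      have "ennreal (exp (- total_rate c x * s) * c x \<sigma>) * trans_upto c n (t - s) (act \<sigma> x) y \<noteq> 0"
        using s \<sigma> n[of "t - s"] by (simp add: zero_less_iff_neq_zero)
      then have "(\<Sum>\<sigma>\<in>UNIV. ennreal (exp (- total_rate c x * s) * c x \<sigma>) *
          trans_upto c n (t - s) (act \<sigma> x) y) \<noteq> 0"
        unfolding sum_eq_0_iff[OF finite] by blast
      then show ?thesis using s by (simp add: indicator_def)
    qed
    have "(\<integral>\<^sup>+ s. ?f s \<partial>lborel) \<noteq> 0"
    proof
      assume "(\<integral>\<^sup>+ s. ?f s \<partial>lborel) = 0"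
      then have "AE s in lborel. ?f s = 0"
        by (subst (asm) nn_integral_0_iff_AE) auto
      then have "AE s in lborel. s \<notin> {0<..<t}"
        by eventually_elim (use fpos in blast)
      then have "emeasure lborel {0<..<t} = 0"
        by (subst (asm) AE_iff_measurable[of "{0<..<t}"]) auto
      then show False using t by simp
    qed
    then show ?thesis by (simp add: zero_less_iff_neq_zero)
  qed
  then show ?case by blast
qed

lemma transition_pos:
  assumes "irreducible_rates c" "t > 0"
  shows "transition c t x y > 0"
proof -
  obtain n where "trans_upto c n t x y > 0"
    using trans_upto_pos[of x y c] assms unfolding irreducible_rates_def by blast
  also have "trans_upto c n t x y \<le> transition c t x y"
    unfolding transition_def by (rule SUP_upper) simp
  finally show ?thesis .
qed

lemma law_mass_total:
  "(\<integral>\<^sup>+ y. law_mass c \<mu> t y \<partial>count_space UNIV) =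
   (\<integral>\<^sup>+ x. (\<integral>\<^sup>+ y. transition c t x y \<partial>count_space UNIV) \<partial>measure_pmf \<mu>)"
  unfolding law_mass_def by (rule nn_integral_count_space_nn_integral[symmetric]) auto

lemma property_Irr_nonexplosive:
  fixes c :: "'d::finite rates"
  assumes c: "\<And>x \<sigma>. 0 \<le> c x \<sigma>" and irr: "property_Irr c m" and t: "0 < t"
  shows "(\<integral>\<^sup>+ y. transition c t x y \<partial>count_space UNIV) = 1"
proof -
  let ?S = "\<lambda>x. \<integral>\<^sup>+ y. transition c t x y \<partial>count_space UNIV"
  have inv: "law_mass c m t y = ennreal (pmf m y)" for y
    using irr t by (simp add: property_Irr_def invariant_law_def)
  have pos: "0 < pmf m y" for y
  proof -
    have "\<not> (AE z in measure_pmf m. transition c t z y = 0)"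
    proof
      assume "AE z in measure_pmf m. transition c t z y = 0"
      moreover have "\<And>z. transition c t z y \<noteq> 0"
        using transition_pos[of c t] irr t by (simp add: property_Irr_def zero_less_iff_neq_zero)
      ultimately show False by simp
    qed
    then have "law_mass c m t y \<noteq> 0"
      by (simp add: law_mass_def nn_integral_0_iff_AE)
    then show ?thesis using inv[of y] by (simp add: pmf_nonneg order_less_le)
  qed
  have "(\<integral>\<^sup>+ x. ?S x \<partial>measure_pmf m) = (\<integral>\<^sup>+ y. law_mass c m t y \<partial>count_space UNIV)"
    by (rule law_mass_total[symmetric])
  also have "\<dots> = 1" by (simp add: inv nn_integral_pmf)
  finally have one: "(\<integral>\<^sup>+ x. ?S x \<partial>measure_pmf m) = 1" .
  have le: "?S x \<le> 1" for x using t by (intro transition_mass c) simp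
  have "(\<integral>\<^sup>+ x. 1 - ?S x \<partial>measure_pmf m) = (\<integral>\<^sup>+ x. 1 \<partial>measure_pmf m) - (\<integral>\<^sup>+ x. ?S x \<partial>measure_pmf m)"
    by (rule nn_integral_diff) (auto simp: one le)
  also have "\<dots> = 0" by (simp add: one)
  finally have "AE x in measure_pmf m. 1 - ?S x = 0"
    by (simp add: nn_integral_0_iff_AE)
  then have "1 - ?S x = 0"
    using pos[of x] by (simp add: AE_measure_pmf_iff set_pmf_iff)
  then show ?thesis using le[of x]
    by (metis diff_add_cancel_ennreal add_0 antisym)
qed

lemma law_mass_total_1:
  fixes c :: "'d::finite rates"
  assumes "\<And>x \<sigma>. 0 \<le> c x \<sigma>" and "property_Irr c m" and "0 < t"
  shows "(\<integral>\<^sup>+ y. law_mass c \<mu> t y \<partial>count_space UNIV) = 1"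
  by (simp add: law_mass_total property_Irr_nonexplosive[OF assms])

lemma pmf_law_at:
  fixes c :: "'d::finite rates"
  assumes c: "\<And>x \<sigma>. 0 \<le> c x \<sigma>" and irr: "property_Irr c m" and t: "0 < t"
  shows "ennreal (pmf (law_at c \<mu> t) y) = law_mass c \<mu> t y"
proof -
  have fin: "law_mass c \<mu> t y < \<top>" for y
  proof -
    have "law_mass c \<mu> t y \<le> (\<integral>\<^sup>+ x. 1 \<partial>measure_pmf \<mu>)"
      unfolding law_mass_def using t by (intro nn_integral_mono transition_le_1 c) simp
    then show ?thesis by (simp add: order_le_less_trans)
  qed
  have "(\<integral>\<^sup>+ y. law_mass c \<mu> t y \<partial>count_space UNIV) = 1"
    by (rule law_mass_total_1[OF c irr t])
  then have "pmf (law_at c \<mu> t) y = enn2real (law_mass c \<mu> t y)"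
    unfolding law_at_def by (intro pmf_embed_pmf) (simp_all add: fin)
  then show ?thesis by (simp add: fin)
qed

lemma transition_first_jump:
  "transition c t x y = ennreal (exp (- total_rate c x * t)) * indicator {x} y +
     (\<integral>\<^sup>+ s\<in>{0..t}. (\<Sum>\<sigma>\<in>UNIV. ennreal (exp (- total_rate c x * s) * c x \<sigma>) *
        transition c (t - s) (act \<sigma> x) y) \<partial>lborel)"
proof -
  let ?a = "ennreal (exp (- total_rate c x * t)) * indicator {x} y :: ennreal"
  let ?w = "\<lambda>s \<sigma>. ennreal (exp (- total_rate c x * s) * c x \<sigma>)"
  let ?f = "\<lambda>n s. (\<Sum>\<sigma>\<in>UNIV. ?w s \<sigma> * trans_upto c n (t - s) (act \<sigma> x) y) * indicator {0..t} s"
  have inc: "incseq ?f"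
    by (intro incseq_SucI le_funI mult_right_mono sum_mono mult_left_mono trans_upto_mono zero_le)
  have "transition c t x y = (SUP n. trans_upto c (Suc n) t x y)"
    unfolding transition_def
  proof (rule antisym)
    show "(SUP n. trans_upto c n t x y) \<le> (SUP n. trans_upto c (Suc n) t x y)"
      by (rule SUP_mono) (use trans_upto_mono in blast)
    show "(SUP n. trans_upto c (Suc n) t x y) \<le> (SUP n. trans_upto c n t x y)"
      by (rule SUP_mono) blast
  qed
  also have "\<dots> = (SUP n. ?a + (\<integral>\<^sup>+ s. ?f n s \<partial>lborel))"
    by (simp only: trans_upto.simps)
  also have "\<dots> = ?a + (SUP n. \<integral>\<^sup>+ s. ?f n s \<partial>lborel)"
    by (rule ennreal_SUP_add_right[symmetric]) simp
  also have "(SUP n. \<integral>\<^sup>+ s. ?f n s \<partial>lborel) = (\<integral>\<^sup>+ s. (SUP n. ?f n s) \<partial>lborel)"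
    by (rule nn_integral_monotone_convergence_SUP[symmetric, OF inc]) measurable
  also have "(\<lambda>s. SUP n. ?f n s) =
      (\<lambda>s. (\<Sum>\<sigma>\<in>UNIV. ?w s \<sigma> * transition c (t - s) (act \<sigma> x) y) * indicator {0..t} s)"
  proof
    fix s
    have "(\<Sum>\<sigma>\<in>UNIV. ?w s \<sigma> * transition c (t - s) (act \<sigma> x) y) =
        (\<Sum>\<sigma>\<in>UNIV. SUP n. ?w s \<sigma> * trans_upto c n (t - s) (act \<sigma> x) y)"
      by (simp add: transition_def SUP_mult_left_ennreal)
    also have "\<dots> = (SUP n. \<Sum>\<sigma>\<in>UNIV. ?w s \<sigma> * trans_upto c n (t - s) (act \<sigma> x) y)"
      by (rule ennreal_SUP_sum[symmetric])
         (intro incseq_SucI mult_left_mono trans_upto_mono zero_le)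
    finally show "(SUP n. ?f n s) =
        (\<Sum>\<sigma>\<in>UNIV. ?w s \<sigma> * transition c (t - s) (act \<sigma> x) y) * indicator {0..t} s"
      by (simp add: SUP_mult_right_ennreal)
  qed
  finally show ?thesis .
qed

lemma generator_total_rate:
  fixes c :: "'d::finite rates"
  shows "generator c f x = (\<Sum>\<sigma>\<in>UNIV. c x \<sigma> * f (act \<sigma> x)) - total_rate c x * f x"
proof -
  have *: "(\<Sum>\<sigma>\<in>UNIV. g \<sigma>) = (\<Sum>i\<in>UNIV. g (Inc i) + g (Dec i))" for g :: "'d move \<Rightarrow> real"
    unfolding UNIV_move
    by (subst sum.union_disjoint) (auto simp: sum.reindex inj_on_def sum.distrib)
  show ?thesis
    by (simp add: generator_def total_rate_def * grad_def sum_distrib_left sum_subtractf sum.distrib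
        algebra_simps del: act.simps)
qed

lemma transition_variation_of_constants:
  fixes c :: "'d::finite rates" and x y :: "'d state"
  assumes c: "\<And>x \<sigma>. 0 \<le> c x \<sigma>" and t: "0 \<le> t"
  defines "f \<equiv> \<lambda>u. \<Sum>\<sigma>\<in>UNIV. c x \<sigma> * enn2real (transition c u (act \<sigma> x) y)"
  shows "(\<lambda>u. exp (total_rate c x * u) * f u) integrable_on {0..t}" (is ?int)
    and "enn2real (transition c t x y) =
       exp (- total_rate c x * t) *
         (indicator {x} y + integral {0..t} (\<lambda>u. exp (total_rate c x * u) * f u))" (is ?eq)
proof -
  let ?q = "total_rate c x"
  let ?g = "\<lambda>u. exp (?q * u) * f u"
  have q: "0 \<le> ?q" by (rule total_rate_nonneg) (rule c)
  have [measurable]: "f \<in> borel_measurable borel"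
    unfolding f_def by measurable
  have f0: "0 \<le> f u" for u unfolding f_def by (intro sum_nonneg mult_nonneg_nonneg c) simp
  have fle: "f u \<le> ?q" if "0 \<le> u" for u
    unfolding f_def total_rate_def using transition_le_1[of c u] that c
    by (intro sum_mono mult_left_le) (auto simp: enn2real_leI)
  have si: "set_integrable lborel {0..t} ?g"
    unfolding set_integrable_def
  proof (rule integrableI_bounded_set_indicator[where B = "exp (?q * t) * ?q"])
    show "AE u in lborel. u \<in> {0..t} \<longrightarrow> norm (?g u) \<le> exp (?q * t) * ?q"
      using q by (intro AE_I2 impI) (auto simp: abs_mult f0 intro!: mult_mono fle mult_left_mono)
  qed (auto simp: emeasure_lborel_Icc_eq)
  show ?int by (rule set_borel_integral_eq_integral[OF si])
  have fin: "transition c u z y < \<top>" if "0 \<le> u" for u z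
    using transition_le_1[of c u z y] c that by (simp add: order_le_less_trans)
  have "(\<integral>\<^sup>+ s\<in>{0..t}. (\<Sum>\<sigma>\<in>UNIV. ennreal (exp (- ?q * s) * c x \<sigma>) *
        transition c (t - s) (act \<sigma> x) y) \<partial>lborel) =
      (\<integral>\<^sup>+ s. ennreal (indicator {0..t} s * (exp (- ?q * s) * f (t - s))) \<partial>lborel)"
  proof (intro nn_integral_cong)
    fix s
    have "(\<Sum>\<sigma>\<in>UNIV. ennreal (exp (- ?q * s) * c x \<sigma>) * transition c (t - s) (act \<sigma> x) y) =
        ennreal (exp (- ?q * s) * f (t - s))" if "s \<in> {0..t}"
    proof -
      have "transition c (t - s) (act \<sigma> x) y =
          ennreal (enn2real (transition c (t - s) (act \<sigma> x) y))" for \<sigma>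
        using fin[of "t - s" "act \<sigma> x"] that by simp
      then have "(\<Sum>\<sigma>\<in>UNIV. ennreal (exp (- ?q * s) * c x \<sigma>) * transition c (t - s) (act \<sigma> x) y) =
          (\<Sum>\<sigma>\<in>UNIV. ennreal (exp (- ?q * s) * c x \<sigma> * enn2real (transition c (t - s) (act \<sigma> x) y)))"
        by (intro sum.cong refl) (metis c ennreal_mult' enn2real_nonneg exp_ge_zero mult_nonneg_nonneg)
      then show ?thesis
        by (simp add: sum_ennreal c f_def sum_distrib_left mult.assoc)
    qed
    then show "(\<Sum>\<sigma>\<in>UNIV. ennreal (exp (- ?q * s) * c x \<sigma>) * transition c (t - s) (act \<sigma> x) y) *
        indicator {0..t} s = ennreal (indicator {0..t} s * (exp (- ?q * s) * f (t - s)))"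
      by (auto split: split_indicator)
  qed
  also have "\<dots> = (\<integral>\<^sup>+ u. ennreal (indicator {0..t} (t - u) * (exp (- ?q * (t - u)) * f (t - (t - u))))
      \<partial>lborel)"
    by (subst nn_integral_real_affine[where c = "-1" and t = t]) auto
  also have "\<dots> = (\<integral>\<^sup>+ u. ennreal (exp (- ?q * t)) * ennreal (indicator {0..t} u * ?g u) \<partial>lborel)"
    by (intro nn_integral_cong)
       (auto simp: f0 ennreal_mult[symmetric] exp_add[symmetric] algebra_simps split: split_indicator)
  also have "\<dots> = ennreal (exp (- ?q * t)) * (\<integral>\<^sup>+ u. ennreal (indicator {0..t} u * ?g u) \<partial>lborel)"
    by (rule nn_integral_cmult) measurable
  also have "(\<integral>\<^sup>+ u. ennreal (indicator {0..t} u * ?g u) \<partial>lborel) = ennreal (integral {0..t} ?g)"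
    using nn_integral_eq_integral[OF si[unfolded set_integrable_def]]
      set_borel_integral_eq_integral(2)[OF si]
    by (simp add: set_lebesgue_integral_def f0)
  finally have I: "(\<integral>\<^sup>+ s\<in>{0..t}. (\<Sum>\<sigma>\<in>UNIV. ennreal (exp (- ?q * s) * c x \<sigma>) *
        transition c (t - s) (act \<sigma> x) y) \<partial>lborel) =
      ennreal (exp (- ?q * t)) * ennreal (integral {0..t} ?g)" .
  have G0: "0 \<le> integral {0..t} ?g"
    by (intro integral_nonneg \<open>?int\<close>) (simp add: f0)
  have "transition c t x y =
      ennreal (exp (- ?q * t) * (indicator {x} y + integral {0..t} ?g))"
    unfolding transition_first_jump[of c t x y] I
    using G0 by (auto simp: ennreal_mult[symmetric] ennreal_plus[symmetric] distrib_left
        simp del: ennreal_plus split: split_indicator)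
  then show ?eq using G0 by simp
qed

lemma continuous_on_transition:
  fixes c :: "'d::finite rates"
  assumes c: "\<And>x \<sigma>. 0 \<le> c x \<sigma>"
  shows "continuous_on {0..b} (\<lambda>t. enn2real (transition c t x y))"
proof (cases "0 \<le> b")
  case True
  show ?thesis
    by (subst continuous_on_cong[OF refl transition_variation_of_constants(2)[OF c]])
       (auto intro!: continuous_intros indefinite_integral_continuous_1
          transition_variation_of_constants(1)[OF c True])
qed simp

lemma backward_equation:
  fixes c :: "'d::finite rates"
  assumes c: "\<And>x \<sigma>. 0 \<le> c x \<sigma>" and t: "0 < t"
  shows "((\<lambda>t. enn2real (transition c t x y)) has_real_derivative
           generator c (\<lambda>x. enn2real (transition c t x y)) x) (at t)"
proof -
  let ?q = "total_rate c x"
  define f where "f u = (\<Sum>\<sigma>\<in>UNIV. c x \<sigma> * enn2real (transition c u (act \<sigma> x) y))" for u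
  let ?G = "\<lambda>s. integral {0..s} (\<lambda>u. exp (?q * u) * f u)"
  have eq: "enn2real (transition c s x y) = exp (- ?q * s) * (indicator {x} y + ?G s)"
    if "0 \<le> s" for s
    unfolding f_def by (rule transition_variation_of_constants(2)) (use c that in auto)
  have "continuous_on {0..t + 1} f"
    unfolding f_def by (intro continuous_intros continuous_on_transition c)
  then have "(?G has_real_derivative exp (?q * t) * f t) (at t within {0..t + 1})"
    using t by (intro integral_has_real_derivative) (auto intro!: continuous_intros)
  then have G: "(?G has_real_derivative exp (?q * t) * f t) (at t)"
    using t at_within_Icc_at[of 0 t "t + 1"] by simp
  have "((\<lambda>s. exp (- ?q * s)) has_real_derivative exp (- ?q * t) * - ?q) (at t)"
    by (auto intro!: derivative_eq_intros)
  from DERIV_mult[OF this DERIV_add[OF DERIV_const[of "indicator {x} y"] G]]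
  have "((\<lambda>s. exp (- ?q * s) * (indicator {x} y + ?G s)) has_real_derivative
      exp (- ?q * t) * - ?q * (indicator {x} y + ?G t) + exp (?q * t) * f t * exp (- ?q * t)) (at t)"
    by (simp only: add_0)
  also have "exp (- ?q * t) * - ?q * (indicator {x} y + ?G t) + exp (?q * t) * f t * exp (- ?q * t) =
      generator c (\<lambda>x. enn2real (transition c t x y)) x"
  proof -
    have "exp (?q * t) * f t * exp (- ?q * t) = f t" by (simp add: exp_minus)
    moreover have "enn2real (transition c t x y) = exp (- ?q * t) * (indicator {x} y + ?G t)"
      using t by (intro eq) simp
    ultimately show ?thesis
      unfolding generator_total_rate f_def[symmetric] by (simp only: mult_ac)
  qed
  finally show ?thesis
  proof (rule has_field_derivative_transform_within_open[where S = "{0<..}"])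
    show "exp (- ?q * s) * (indicator {x} y + ?G s) = enn2real (transition c s x y)"
      if "s \<in> {0<..}" for s using that by (simp add: eq)
  qed (use t in auto)
qed

section \<open>Wasserstein distances\<close>

definition ell1 :: "'d::finite state \<Rightarrow> 'd state \<Rightarrow> real" where
  "ell1 \<eta> \<eta>' = (\<Sum>i\<in>UNIV. \<bar>real (\<eta> $ i) - real (\<eta>' $ i)\<bar>)"

definition finite_moment_laws :: "real \<Rightarrow> 'd::finite state pmf set" where
  "finite_moment_laws p = {\<mu>. (\<integral>\<^sup>+ \<eta>. ennreal (ell1 \<eta> 0 powr p) \<partial>measure_pmf \<mu>) < \<infinity>}"

definition couplings :: "'a pmf \<Rightarrow> 'a pmf \<Rightarrow> ('a \<times> 'a) pmf set" where
  "couplings \<mu> \<nu> = {\<pi>. map_pmf fst \<pi> = \<mu> \<and> map_pmf snd \<pi> = \<nu>}"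

definition ennreal_powr :: "ennreal \<Rightarrow> real \<Rightarrow> ennreal" where
  "ennreal_powr x a = (if x = \<infinity> then \<infinity> else ennreal (enn2real x powr a))"

text \<open>
  \<open>ennreal_powr\<close> is only meant for positive exponents.  The distance is extended-valued, so a
  bound on \<open>wasserstein p \<mu>\<^sub>t \<nu>\<^sub>t\<close> includes its finiteness.
\<close>

definition wasserstein :: "real \<Rightarrow> 'd::finite state pmf \<Rightarrow> 'd state pmf \<Rightarrow> ennreal" where
  "wasserstein p \<mu> \<nu> =
     ennreal_powr
       (INF \<pi>\<in>couplings \<mu> \<nu>. \<integral>\<^sup>+ (\<eta>, \<eta>'). ennreal (ell1 \<eta> \<eta>' powr p) \<partial>measure_pmf \<pi>)
       (1 / p)"

section \<open>Rates given by potentials and the curvature quantities\<close>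

fun potential_rates :: "('d::finite state \<Rightarrow> real) \<Rightarrow> ('d state \<Rightarrow> real) \<Rightarrow> 'd rates" where
  "potential_rates Vm Vp \<eta> (Inc i) = exp (- grad (Inc i) Vp \<eta>)"
| "potential_rates Vm Vp \<eta> (Dec i) = exp (- grad (Dec i) Vm \<eta>) * of_bool (\<eta> $ i > 0)"

definition kappa_plus :: "'d::finite rates \<Rightarrow> 'd state \<Rightarrow> 'd \<Rightarrow> real" where
  "kappa_plus c \<eta> i =
     - grad (Inc i) (\<lambda>\<xi>. c \<xi> (Inc i)) \<eta>
     - (\<Sum>\<gamma>\<in>UNIV - {Inc i, Dec i}. max (grad (Inc i) (\<lambda>\<xi>. c \<xi> \<gamma>) \<eta>) 0)"

definition kappa_minus :: "'d::finite rates \<Rightarrow> 'd state \<Rightarrow> 'd \<Rightarrow> real" where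
  "kappa_minus c \<eta> i =
     grad (Inc i) (\<lambda>\<xi>. c \<xi> (Dec i)) \<eta>
     - (\<Sum>\<gamma>\<in>UNIV - {Inc i, Dec i}. max (- grad (Inc i) (\<lambda>\<xi>. c \<xi> \<gamma>) \<eta>) 0)"

end

theory Submission
  imports Defs
begin

text \<open>
  Both \<open>kappa_plus\<close> and \<open>kappa_minus\<close> are instances of one curvature attached to a move
  \<open>\<sigma>\<close> from \<open>x\<close> to a neighbour \<open>y\<close>: the rate of \<open>\<sigma>\<close> at \<open>x\<close> minus its rate at \<open>y\<close> minus the total excess at \<open>y\<close> of the rates of
  the moves in the other directions.  If all curvatures are nonnegative, the chains started in \<open>x\<close>
  and \<open>y\<close> can be coupled so that they stay adjacent until they meet, and they meet at rate the sum of
  the two curvatures of the edge.  Gluing such couplings along a shortest path and mixing over a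
  coupling of the initial laws gives the contraction for every \<open>p\<close>.  Conversely, as \<open>p\<close> grows at fixed
  \<open>t\<close>, the contraction provides couplings of the laws at time \<open>t\<close> of chains started in neighbours
  which are at distance at least 2 with probability at most \<open>t\<^sup>2\<close>; comparing the one-jump
  probabilities to first order in \<open>t\<close> bounds the meeting rate at each endpoint by a curvature.
\<close>

section \<open>Minimal jump chains\<close>

text \<open>All exponents are handled by two bounds on one coupling: its distance d never exceeds
  the initial distance D, and the mean of d is at most e^(-\<kappa> t) D. As d^p \<le> D^(p-1) d,
  the cost of order p decays at rate \<kappa>, and the p-th root turns this into \<kappa>/p. The
  same scaling serves the converse: between neighbours the cost of order p is bounded by
  e^(-\<kappa> t) whatever p is, so Markov's inequality at height 2^p makes distances of at least 2
  negligible.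

  The obstacle is that the rates of decreasing moves are not assumed bounded. The coupled chain is
  therefore constructed as a minimal chain, and its non-explosion has to be proved by a Lyapunov
  function. Comparison of minimal chains gives inequalities only: the marginals of the coupled law
  are dominated by the laws of the single chains, and equality follows since both have mass
  1.\<close>

definition exit_rate :: "('s \<Rightarrow> 'k::finite \<Rightarrow> real) \<Rightarrow> 's \<Rightarrow> real" where
  "exit_rate r z = (\<Sum>k\<in>UNIV. r z k)"

text \<open>The mean of \<open>g\<close> at time \<open>t\<close> on the event of fewer than
  \<open>n\<close> jumps. A general \<open>g\<close> lets one comparison principle control total
  mass, marginals and distances. Jumps carry labels in \<open>'k\<close>, so that the projection of
  a jump to one component of a pair can be read off its label.\<close>

primrec jump_upto ::
    "('k::finite \<Rightarrow> 's \<Rightarrow> 's) \<Rightarrow> ('s \<Rightarrow> 'k \<Rightarrow> real) \<Rightarrow> ('s \<Rightarrow> ennreal) \<Rightarrow> nat \<Rightarrow> real \<Rightarrow> 's \<Rightarrow> ennreal" where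
  "jump_upto a r g 0 = (\<lambda>t z. 0)"
| "jump_upto a r g (Suc n) = (\<lambda>t z.
     ennreal (exp (- exit_rate r z * t)) * g z +
     (\<integral>\<^sup>+ s\<in>{0..t}. (\<Sum>k\<in>UNIV. ennreal (exp (- exit_rate r z * s) * r z k) *
        jump_upto a r g n (t - s) (a k z)) \<partial>lborel))"

section \<open>Laws of minimal chains and the comparison principle\<close>

lemma measurable_jump_upto [measurable]:
  "(\<lambda>t. jump_upto a r g n t z) \<in> borel_measurable borel"
proof (induction n arbitrary: z)
  case 0 show ?case by simp
next
  case (Suc n)
  note [measurable] = Suc
  show ?case unfolding jump_upto.simps atLeastAtMost_iff indicator_def by measurable
qed

lemma jump_upto_mono: "jump_upto a r g n t z \<le> jump_upto a r g (Suc n) t z"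
proof (induction n arbitrary: t z)
  case 0 show ?case by simp
next
  case (Suc n)
  show ?case
    by (subst (1 2) jump_upto.simps(2))
       (intro add_mono nn_integral_mono mult_right_mono sum_mono mult_left_mono Suc order_refl zero_le)
qed

text \<open>Tonelli's theorem in the first-jump recursion. This reduces arbitrary test functions to
  point masses, from which a law can be built.\<close>

lemma jump_upto_kernel:
  fixes z :: "'s::countable"
  shows "jump_upto a r g n t z =
    (\<integral>\<^sup>+ w. jump_upto a r (indicator {w}) n t z * g w \<partial>count_space UNIV)"
proof (induction n arbitrary: t z)
  case 0 show ?case by simp
next
  case (Suc n)
  let ?e = "\<lambda>s k. ennreal (exp (- exit_rate r z * s) * r z k)"
  let ?I = "\<lambda>w s. (\<Sum>k\<in>UNIV. ?e s k * jump_upto a r (indicator {w}) n (t - s) (a k z)) *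
    indicator {0..t} s"
  have "(\<integral>\<^sup>+ w. jump_upto a r (indicator {w}) (Suc n) t z * g w \<partial>count_space UNIV) =
      (\<integral>\<^sup>+ w. ennreal (exp (- exit_rate r z * t)) * g z * indicator {z} w \<partial>count_space UNIV) +
      (\<integral>\<^sup>+ w. (\<integral>\<^sup>+ s. ?I w s \<partial>lborel) * g w \<partial>count_space UNIV)"
    by (subst nn_integral_add[symmetric])
       (auto intro!: nn_integral_cong simp: distrib_right split: split_indicator)
  also have "(\<integral>\<^sup>+ w. (\<integral>\<^sup>+ s. ?I w s \<partial>lborel) * g w \<partial>count_space UNIV) =
      (\<integral>\<^sup>+ w. (\<integral>\<^sup>+ s. ?I w s * g w \<partial>lborel) \<partial>count_space UNIV)"
    by (intro nn_integral_cong nn_integral_multc[symmetric]) measurable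
  also have "\<dots> = (\<integral>\<^sup>+ s. (\<integral>\<^sup>+ w. ?I w s * g w \<partial>count_space UNIV) \<partial>lborel)"
    by (rule nn_integral_count_space_nn_integral[symmetric]) (simp, measurable)
  also have "\<dots> = (\<integral>\<^sup>+ s\<in>{0..t}. (\<Sum>k\<in>UNIV. ?e s k * jump_upto a r g n (t - s) (a k z)) \<partial>lborel)"
  proof (rule nn_integral_cong)
    fix s
    have "(\<integral>\<^sup>+ w. ?I w s * g w \<partial>count_space UNIV) =
        (\<integral>\<^sup>+ w. (\<Sum>k\<in>UNIV. (?e s k * indicator {0..t} s) *
           (jump_upto a r (indicator {w}) n (t - s) (a k z) * g w)) \<partial>count_space UNIV)"
      by (intro nn_integral_cong) (simp add: sum_distrib_left sum_distrib_right mult_ac)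
    also have "\<dots> = (\<Sum>k\<in>UNIV. (?e s k * indicator {0..t} s) * jump_upto a r g n (t - s) (a k z))"
      by (simp add: nn_integral_sum nn_integral_cmult Suc[symmetric])
    finally show "(\<integral>\<^sup>+ w. ?I w s * g w \<partial>count_space UNIV) =
        (\<Sum>k\<in>UNIV. ?e s k * jump_upto a r g n (t - s) (a k z)) * indicator {0..t} s"
      by (simp add: sum_distrib_right mult_ac)
  qed
  also have "(\<integral>\<^sup>+ w. ennreal (exp (- exit_rate r z * t)) * g z * indicator {z} w \<partial>count_space UNIV) =
      ennreal (exp (- exit_rate r z * t)) * g z"
    by (simp add: nn_integral_cmult)
  finally show ?case by simp
qed

text \<open>In the absence of explosion the limiting point masses add up to 1, and monotone
  convergence carries the kernel representation from each \<open>n\<close> to the supremum.\<close>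

lemma jump_upto_pmf:
  fixes z :: "'s::countable"
  assumes "(SUP n. jump_upto a r (\<lambda>_. 1) n t z) = 1"
  obtains \<pi> where "\<And>g. (\<integral>\<^sup>+ w. g w \<partial>measure_pmf \<pi>) = (SUP n. jump_upto a r g n t z)"
proof -
  define K where "K w = (SUP n. jump_upto a r (indicator {w}) n t z)" for w
  have K: "(\<integral>\<^sup>+ w. K w * g w \<partial>count_space UNIV) = (SUP n. jump_upto a r g n t z)" for g
  proof -
    have "(\<integral>\<^sup>+ w. K w * g w \<partial>count_space UNIV) =
        (\<integral>\<^sup>+ w. (SUP n. jump_upto a r (indicator {w}) n t z * g w) \<partial>count_space UNIV)"
      by (simp add: K_def SUP_mult_right_ennreal)
    also have "\<dots> = (SUP n. \<integral>\<^sup>+ w. jump_upto a r (indicator {w}) n t z * g w \<partial>count_space UNIV)"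
      by (rule nn_integral_monotone_convergence_SUP)
         (auto intro!: incseq_SucI le_funI mult_right_mono jump_upto_mono simp del: jump_upto.simps)
    finally show ?thesis by (simp add: jump_upto_kernel[symmetric])
  qed
  have mass: "(\<integral>\<^sup>+ w. K w \<partial>count_space UNIV) = 1"
    using K[of "\<lambda>_. 1"] assms by simp
  have fin: "K w < \<top>" for w
  proof -
    have "K w = (\<integral>\<^sup>+ v. K v * indicator {w} v \<partial>count_space UNIV)"
      by simp
    also have "\<dots> \<le> (\<integral>\<^sup>+ v. K v \<partial>count_space UNIV)"
      by (intro nn_integral_mono) (auto split: split_indicator)
    finally show ?thesis using mass by (simp add: order_le_less_trans)
  qed
  define \<pi> where "\<pi> = embed_pmf (\<lambda>w. enn2real (K w))"
  have "pmf \<pi> w = enn2real (K w)" for w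
    unfolding \<pi>_def by (rule pmf_embed_pmf) (simp_all add: fin mass)
  then have "(\<integral>\<^sup>+ w. g w \<partial>measure_pmf \<pi>) = (SUP n. jump_upto a r g n t z)" for g
    by (subst measure_pmf_eq_density) (simp add: nn_integral_density fin K)
  then show ?thesis by (rule that)
qed

text \<open>The minimal solution of the first-jump equation lies below every supersolution, by
  induction on the number of jumps. The inequality is needed on \<open>S\<close> only, because
  targets outside \<open>S\<close> come with rate 0.\<close>

lemma jump_upto_le_supersolution:
  assumes r: "\<And>z k. 0 \<le> r z k"
    and closed: "\<And>z k. z \<in> S \<Longrightarrow> r z k > 0 \<Longrightarrow> a k z \<in> S"
    and super: "\<And>t z. z \<in> S \<Longrightarrow> 0 \<le> t \<Longrightarrow>
      ennreal (exp (- exit_rate r z * t)) * g z +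
      (\<integral>\<^sup>+ s\<in>{0..t}. (\<Sum>k\<in>UNIV. ennreal (exp (- exit_rate r z * s) * r z k) *
        H (t - s) (a k z)) \<partial>lborel) \<le> H t z"
    and "z \<in> S" "0 \<le> t"
  shows "jump_upto a r g n t z \<le> H t z"
  using assms(4,5)
proof (induction n arbitrary: t z)
  case 0 show ?case by simp
next
  case (Suc n)
  have "jump_upto a r g (Suc n) t z \<le> ennreal (exp (- exit_rate r z * t)) * g z +
      (\<integral>\<^sup>+ s\<in>{0..t}. (\<Sum>k\<in>UNIV. ennreal (exp (- exit_rate r z * s) * r z k) *
        H (t - s) (a k z)) \<partial>lborel)"
    unfolding jump_upto.simps
  proof (intro add_left_mono nn_integral_mono)
    fix s
    show "(\<Sum>k\<in>UNIV. ennreal (exp (- exit_rate r z * s) * r z k) *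
        jump_upto a r g n (t - s) (a k z)) * indicator {0..t} s
      \<le> (\<Sum>k\<in>UNIV. ennreal (exp (- exit_rate r z * s) * r z k) *
        H (t - s) (a k z)) * indicator {0..t} s"
    proof (cases "s \<in> {0..t}")
      case True
      have "ennreal (exp (- exit_rate r z * s) * r z k) * jump_upto a r g n (t - s) (a k z)
          \<le> ennreal (exp (- exit_rate r z * s) * r z k) * H (t - s) (a k z)" for k
      proof (cases "r z k = 0")
        case False
        then have "a k z \<in> S" using r[of z k] Suc.prems by (intro closed) auto
        then show ?thesis using True by (intro mult_left_mono Suc.IH) auto
      qed simp
      then show ?thesis by (intro mult_right_mono sum_mono) auto
    qed simp
  qed
  also have "\<dots> \<le> H t z" by (rule super) fact+
  finally show ?case .
qed

text \<open>With \<open>b\<close> replaced by its upper bound, the integrand is the derivative in s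
  of -h e^(-q s) e^(\<rho> (t - s)).\<close>

lemma nn_integral_exp_convolution_le:
  fixes q \<rho> b h t :: real
  assumes t: "0 \<le> t" and h: "0 \<le> h" and b: "b \<le> (q + \<rho>) * h" "0 \<le> b"
  shows "(\<integral>\<^sup>+ s\<in>{0..t}. ennreal (exp (- q * s) * (b * exp (\<rho> * (t - s)))) \<partial>lborel)
    \<le> ennreal (h * (exp (\<rho> * t) - exp (- q * t)))"
proof -
  have "(\<integral>\<^sup>+ s\<in>{0..t}. ennreal (exp (- q * s) * (b * exp (\<rho> * (t - s)))) \<partial>lborel)
      \<le> (\<integral>\<^sup>+ s. ennreal (exp (- q * s) * ((q + \<rho>) * h * exp (\<rho> * (t - s)))) * indicator {0..t} s \<partial>lborel)"
    using b by (intro nn_integral_mono mult_right_mono ennreal_leI mult_left_mono) auto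
  also have "\<dots> = ennreal (- h * (exp (- q * t) * exp (\<rho> * (t - t))) -
      (- h * (exp (- q * 0) * exp (\<rho> * (t - 0)))))"
  proof (rule nn_integral_FTC_Icc)
    show "0 \<le> exp (- q * s) * ((q + \<rho>) * h * exp (\<rho> * (t - s)))" for s
      using order_trans[OF b(2,1)] by (intro mult_nonneg_nonneg[of "exp _"] mult_nonneg_nonneg[of "_ * h"]) auto
  qed (use t in \<open>auto intro!: derivative_eq_intros simp: algebra_simps\<close>)
  also have "- h * (exp (- q * t) * exp (\<rho> * (t - t))) - (- h * (exp (- q * 0) * exp (\<rho> * (t - 0)))) =
      h * (exp (\<rho> * t) - exp (- q * t))"
    by (simp add: algebra_simps)
  finally show ?thesis .
qed

text \<open>The parameter \<theta> bounds the factor by which one jump, discounted at rate \<rho>,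
  multiplies \<open>h\<close> in mean. The value 1 serves the growth bound for means, a value below
  1 the count of jumps.\<close>

lemma first_jump_exp_le:
  fixes h :: "'s \<Rightarrow> real"
  assumes r: "\<And>z k. 0 \<le> r z k" and h: "\<And>z. 0 \<le> h z" and t: "0 \<le> t" and C: "0 \<le> C"
    and drift: "(\<Sum>k\<in>UNIV. r z k * h (a k z)) \<le> \<theta> * (exit_rate r z + \<rho>) * h z"
    and \<theta>: "0 \<le> \<theta>"
  shows "(\<integral>\<^sup>+ s\<in>{0..t}. (\<Sum>k\<in>UNIV. ennreal (exp (- exit_rate r z * s) * r z k) *
      ennreal (C * (exp (\<rho> * (t - s)) * h (a k z)))) \<partial>lborel)
    \<le> ennreal (C * \<theta> * h z * (exp (\<rho> * t) - exp (- exit_rate r z * t)))"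
proof -
  let ?b = "C * (\<Sum>k\<in>UNIV. r z k * h (a k z))"
  have "(\<Sum>k\<in>UNIV. ennreal (exp (- exit_rate r z * s) * r z k) *
      ennreal (C * (exp (\<rho> * (t - s)) * h (a k z)))) =
      ennreal (exp (- exit_rate r z * s) * (?b * exp (\<rho> * (t - s))))" for s
  proof -
    have "(\<Sum>k\<in>UNIV. ennreal (exp (- exit_rate r z * s) * r z k) *
        ennreal (C * (exp (\<rho> * (t - s)) * h (a k z)))) =
      (\<Sum>k\<in>UNIV. ennreal (exp (- exit_rate r z * s) * r z k *
        (C * (exp (\<rho> * (t - s)) * h (a k z)))))"
      using r h C by (intro sum.cong refl ennreal_mult[symmetric]) auto
    also have "\<dots> = ennreal (\<Sum>k\<in>UNIV. exp (- exit_rate r z * s) * r z k *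
        (C * (exp (\<rho> * (t - s)) * h (a k z))))"
      using r h C by (intro sum_ennreal) auto
    also have "(\<Sum>k\<in>UNIV. exp (- exit_rate r z * s) * r z k *
        (C * (exp (\<rho> * (t - s)) * h (a k z)))) =
        exp (- exit_rate r z * s) * (?b * exp (\<rho> * (t - s)))"
      by (simp add: sum_distrib_left sum_distrib_right mult_ac)
    finally show ?thesis .
  qed
  moreover have "(\<integral>\<^sup>+ s\<in>{0..t}. ennreal (exp (- exit_rate r z * s) * (?b * exp (\<rho> * (t - s)))) \<partial>lborel)
    \<le> ennreal (C * \<theta> * h z * (exp (\<rho> * t) - exp (- exit_rate r z * t)))"
    using mult_left_mono[OF drift C] C t h \<theta> r
    by (intro nn_integral_exp_convolution_le) (auto intro!: sum_nonneg mult_nonneg_nonneg simp: mult_ac)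
  ultimately show ?thesis by simp
qed

text \<open>Gronwall's inequality for the mean of \<open>h\<close>: the drift hypothesis says that
  the generator maps \<open>h\<close> to at most \<open>\<rho> * h\<close> on \<open>S\<close>, and
  this makes e^(\<rho> t) h a supersolution.\<close>

lemma jump_upto_le_exp:
  fixes h :: "'s \<Rightarrow> real"
  assumes r: "\<And>z k. 0 \<le> r z k"
    and closed: "\<And>z k. z \<in> S \<Longrightarrow> r z k > 0 \<Longrightarrow> a k z \<in> S"
    and h: "\<And>z. 0 \<le> h z"
    and drift: "\<And>z. z \<in> S \<Longrightarrow> (\<Sum>k\<in>UNIV. r z k * h (a k z)) \<le> (exit_rate r z + \<rho>) * h z"
    and "z \<in> S" "0 \<le> t"
  shows "jump_upto a r (\<lambda>z. ennreal (h z)) n t z \<le> ennreal (exp (\<rho> * t) * h z)"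
proof (rule jump_upto_le_supersolution[where S = S and H = "\<lambda>t z. ennreal (exp (\<rho> * t) * h z)"])
  fix t :: real and z assume t: "0 \<le> t" and z: "z \<in> S"
  \<comment> \<open>Here \<rho> may be negative. Since the left side of the drift inequality is
    nonnegative, \<rho> is still at least minus the exit rate wherever \<open>h\<close> is
    positive.\<close>
  have 0: "0 \<le> h z * (exp (\<rho> * t) - exp (- exit_rate r z * t))"
  proof (cases "h z = 0")
    case False
    then have "0 < h z" using h[of z] by simp
    moreover have "0 \<le> (exit_rate r z + \<rho>) * h z"
      by (rule order_trans[OF _ drift[OF z]]) (intro sum_nonneg mult_nonneg_nonneg r h)
    ultimately have "- exit_rate r z \<le> \<rho>" by (simp add: zero_le_mult_iff)
    from mult_right_mono[OF this t] show ?thesis using h by (intro mult_nonneg_nonneg) auto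
  qed simp
  have "ennreal (exp (- exit_rate r z * t)) * ennreal (h z) +
      (\<integral>\<^sup>+ s\<in>{0..t}. (\<Sum>k\<in>UNIV. ennreal (exp (- exit_rate r z * s) * r z k) *
        ennreal (exp (\<rho> * (t - s)) * h (a k z))) \<partial>lborel)
    \<le> ennreal (exp (- exit_rate r z * t) * h z) +
      ennreal (h z * (exp (\<rho> * t) - exp (- exit_rate r z * t)))"
    using first_jump_exp_le[of r h t 1 z a 1 \<rho>] r h drift[OF z] t
    by (intro add_mono) (simp_all add: ennreal_mult)
  also have "\<dots> = ennreal (exp (\<rho> * t) * h z)"
    using 0 h by (subst ennreal_plus[symmetric]) (auto simp: algebra_simps)
  finally show "ennreal (exp (- exit_rate r z * t)) * ennreal (h z) +
      (\<integral>\<^sup>+ s\<in>{0..t}. (\<Sum>k\<in>UNIV. ennreal (exp (- exit_rate r z * s) * r z k) *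
        ennreal (exp (\<rho> * (t - s)) * h (a k z))) \<partial>lborel) \<le> ennreal (exp (\<rho> * t) * h z)" .
qed (use assms in auto)

section \<open>A Lyapunov criterion for non-explosion\<close>

lemma first_jump_mass:
  assumes r: "\<And>z k. 0 \<le> r z k" and t: "0 \<le> t"
  shows "ennreal (exp (- exit_rate r z * t)) +
      (\<integral>\<^sup>+ s\<in>{0..t}. (\<Sum>k\<in>UNIV. ennreal (exp (- exit_rate r z * s) * r z k)) \<partial>lborel) = 1"
proof -
  let ?q = "exit_rate r z"
  have q: "0 \<le> ?q" unfolding exit_rate_def by (intro sum_nonneg r)
  have "(\<integral>\<^sup>+ s\<in>{0..t}. (\<Sum>k\<in>UNIV. ennreal (exp (- ?q * s) * r z k)) \<partial>lborel) =
      (\<integral>\<^sup>+ s. ennreal (exp (- ?q * s) * ?q) * indicator {0..t} s \<partial>lborel)"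
    by (simp add: sum_ennreal r exit_rate_def sum_distrib_left)
  also have "\<dots> = ennreal (- exp (- ?q * t) - (- exp (- ?q * 0)))"
    using t q by (intro nn_integral_FTC_Icc) (auto intro!: derivative_eq_intros)
  finally show ?thesis using q t by (simp add: ennreal_plus[symmetric] del: ennreal_plus)
qed

lemma jump_upto_mass_le:
  assumes r: "\<And>z k. 0 \<le> r z k" and t: "0 \<le> t"
  shows "jump_upto a r (\<lambda>_. 1) n t z \<le> 1"
  by (rule jump_upto_le_supersolution[where S = UNIV and H = "\<lambda>_ _. 1"])
     (use r t first_jump_mass[of r, OF r] in \<open>simp_all del: sum_ennreal\<close>)

text \<open>The summand on the right bounds the probability of at least \<open>n\<close> jumps up to time \<open>t\<close>.\<close>

lemma jump_upto_mass_ge: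
  fixes h :: "'s \<Rightarrow> real"
  assumes r: "\<And>z k. 0 \<le> r z k" and h: "\<And>z. 1 \<le> h z" and \<theta>: "0 \<le> \<theta>" and \<rho>: "0 \<le> \<rho>"
    and drift: "\<And>z. (\<Sum>k\<in>UNIV. r z k * h (a k z)) \<le> \<theta> * (exit_rate r z + \<rho>) * h z"
    and t: "0 \<le> t"
  shows "1 \<le> jump_upto a r (\<lambda>_. 1) n t z + ennreal (\<theta> ^ n * (exp (\<rho> * t) * h z))"
  using t
proof (induction n arbitrary: t z)
  case 0
  have "1 * 1 \<le> exp (\<rho> * t) * h z" using 0 \<rho> h by (intro mult_mono) auto
  then show ?case by simp
next
  case (Suc n)
  let ?q = "exit_rate r z"
  have h0: "0 \<le> h z" for z using h[of z] by simp
  let ?D = "\<lambda>t z. ennreal (\<theta> ^ n * (exp (\<rho> * t) * h z))"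
  let ?U = "jump_upto a r (\<lambda>_. 1) n"
  let ?e = "\<lambda>s k. ennreal (exp (- ?q * s) * r z k)"
  have "(1::ennreal) = ennreal (exp (- ?q * t)) + (\<integral>\<^sup>+ s\<in>{0..t}. (\<Sum>k\<in>UNIV. ?e s k) \<partial>lborel)"
    by (rule first_jump_mass[symmetric]) (use r Suc in auto)
  also have "\<dots> \<le> ennreal (exp (- ?q * t)) +
      (\<integral>\<^sup>+ s. (\<Sum>k\<in>UNIV. ?e s k * ?U (t - s) (a k z)) * indicator {0..t} s +
        (\<Sum>k\<in>UNIV. ?e s k * ?D (t - s) (a k z)) * indicator {0..t} s \<partial>lborel)"
  proof (intro add_left_mono nn_integral_mono)
    fix s
    show "(\<Sum>k\<in>UNIV. ?e s k) * indicator {0..t} s \<le>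
        (\<Sum>k\<in>UNIV. ?e s k * ?U (t - s) (a k z)) * indicator {0..t} s +
        (\<Sum>k\<in>UNIV. ?e s k * ?D (t - s) (a k z)) * indicator {0..t} s"
    proof (cases "s \<in> {0..t}")
      case True
      have "?e s k * 1 \<le> ?e s k * (?U (t - s) (a k z) + ?D (t - s) (a k z))" for k
        using True by (intro mult_left_mono Suc.IH) auto
      then show ?thesis using True
        by (simp add: sum.distrib[symmetric] distrib_left sum_mono del: sum.distrib)
    qed simp
  qed
  also have "\<dots> = jump_upto a r (\<lambda>_. 1) (Suc n) t z +
      (\<integral>\<^sup>+ s\<in>{0..t}. (\<Sum>k\<in>UNIV. ?e s k * ?D (t - s) (a k z)) \<partial>lborel)"
    by (subst nn_integral_add) (auto simp: add_ac)
  also have "\<dots> \<le> jump_upto a r (\<lambda>_. 1) (Suc n) t z +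
      ennreal (\<theta> ^ n * \<theta> * h z * (exp (\<rho> * t) - exp (- ?q * t)))"
    by (intro add_left_mono first_jump_exp_le r h0 Suc.prems drift \<theta>) (use \<theta> in simp)
  also have "\<dots> \<le> jump_upto a r (\<lambda>_. 1) (Suc n) t z + ennreal (\<theta> ^ Suc n * (exp (\<rho> * t) * h z))"
  proof (intro add_left_mono ennreal_leI)
    have "\<theta> ^ n * \<theta> * h z * (exp (\<rho> * t) - exp (- ?q * t)) \<le> \<theta> ^ n * \<theta> * h z * exp (\<rho> * t)"
      using \<theta> h0 by (intro mult_left_mono) auto
    then show "\<theta> ^ n * \<theta> * h z * (exp (\<rho> * t) - exp (- ?q * t)) \<le> \<theta> ^ Suc n * (exp (\<rho> * t) * h z)"
      by (simp add: mult_ac)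
  qed
  finally show ?case .
qed

text \<open>Under discounting at rate \<rho> every jump gains a factor \<theta> < 1 in the mean of
  \<open>h\<close>. So \<open>n\<close> jumps before time \<open>t\<close> have probability at most
  \<theta>^n e^(\<rho> t) h, which tends to 0.\<close>

lemma jump_upto_mass:
  fixes h :: "'s \<Rightarrow> real"
  assumes r: "\<And>z k. 0 \<le> r z k" and h: "\<And>z. 1 \<le> h z"
    and \<theta>: "0 \<le> \<theta>" "\<theta> < 1" and \<rho>: "0 \<le> \<rho>"
    and drift: "\<And>z. (\<Sum>k\<in>UNIV. r z k * h (a k z)) \<le> \<theta> * (exit_rate r z + \<rho>) * h z"
    and t: "0 \<le> t"
  shows "(SUP n. jump_upto a r (\<lambda>_. 1) n t z) = 1"
proof (rule antisym)
  show "(SUP n. jump_upto a r (\<lambda>_. 1) n t z) \<le> 1"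
    by (intro SUP_least jump_upto_mass_le r t)
  have "(\<lambda>n. \<theta> ^ n * (exp (\<rho> * t) * h z)) \<longlonglongrightarrow> 0 * (exp (\<rho> * t) * h z)"
    using \<theta> by (intro tendsto_intros LIMSEQ_realpow_zero) auto
  then have "(\<lambda>n. ennreal (\<theta> ^ n * (exp (\<rho> * t) * h z))) \<longlonglongrightarrow> 0"
    by (metis ennreal_0 mult_zero_left tendsto_ennrealI)
  then have "(\<lambda>n. (SUP n. jump_upto a r (\<lambda>_. 1) n t z) + ennreal (\<theta> ^ n * (exp (\<rho> * t) * h z)))
      \<longlonglongrightarrow> (SUP n. jump_upto a r (\<lambda>_. 1) n t z) + 0"
    by (intro tendsto_intros)
  moreover have "1 \<le> (SUP n. jump_upto a r (\<lambda>_. 1) n t z) + ennreal (\<theta> ^ n * (exp (\<rho> * t) * h z))" for n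
    by (rule order_trans[OF jump_upto_mass_ge[OF r h \<theta>(1) \<rho> drift t, of n z]])
       (intro add_right_mono SUP_upper, simp)
  ultimately show "1 \<le> (SUP n. jump_upto a r (\<lambda>_. 1) n t z)"
    by (intro LIMSEQ_le_const[where
          X = "\<lambda>n. (SUP n. jump_upto a r (\<lambda>_. 1) n t z) + ennreal (\<theta> ^ n * (exp (\<rho> * t) * h z))"]) auto
qed

section \<open>Coupling the rates of adjacent states\<close>

lemma inv_move_inv_move [simp]: "inv_move (inv_move \<sigma>) = \<sigma>"
  by (cases \<sigma>) auto

lemma inv_move_neq [simp]: "inv_move \<sigma> \<noteq> \<sigma>" "\<sigma> \<noteq> inv_move \<sigma>"
  by (cases \<sigma>; simp)+

lemma act_nth:
  "act (Inc i) x $ j = x $ j + of_bool (i = j)"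
  "act (Dec i) x $ j = x $ j - of_bool (i = j)"
  by (auto simp: axis_def)

lemma act_inv_move: "act \<sigma> x \<noteq> x \<Longrightarrow> act (inv_move \<sigma>) (act \<sigma> x) = x"
  by (cases \<sigma>) (auto simp: vec_eq_iff axis_def split: if_splits)

lemma act_Inc_neq: "act (Inc i) x \<noteq> x"
  by (auto simp: vec_eq_iff axis_def)

lemma ell1_self [simp]: "ell1 x x = 0"
  by (simp add: ell1_def)

lemma ell1_nonneg [simp]: "0 \<le> ell1 x y"
  by (simp add: ell1_def sum_nonneg)

lemma ell1_commute: "ell1 x y = ell1 y x"
  by (simp add: ell1_def abs_minus_commute)

lemma ell1_triangle: "ell1 x z \<le> ell1 x y + ell1 y z"
  unfolding ell1_def sum.distrib[symmetric] by (intro sum_mono) linarith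

lemma ell1_nat: obtains n where "ell1 x y = real n"
proof
  show "ell1 x y = real (\<Sum>i\<in>UNIV. nat \<bar>int (x $ i) - int (y $ i)\<bar>)"
    by (simp add: ell1_def)
qed

lemma ell1_ge_1: "x \<noteq> y \<Longrightarrow> 1 \<le> ell1 x y"
proof -
  assume "x \<noteq> y"
  then obtain i where i: "x $ i \<noteq> y $ i" by (auto simp: vec_eq_iff)
  then have "1 \<le> \<bar>real (x $ i) - real (y $ i)\<bar>" by linarith
  also have "\<dots> \<le> ell1 x y"
    unfolding ell1_def by (rule member_le_sum) auto
  finally show ?thesis .
qed

lemma ell1_eq_0_iff [simp]: "ell1 x y = 0 \<longleftrightarrow> x = y"
  using ell1_ge_1[of x y] by fastforce

text \<open>Truncated subtraction is 1-Lipschitz in each coordinate, so the same move never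
  separates two chains, even if it is blocked for one of them.\<close>

lemma ell1_act_act: "ell1 (act \<sigma> x) (act \<sigma> y) \<le> ell1 x y"
  unfolding ell1_def
  by (cases \<sigma>; intro sum_mono; simp add: act_nth del: act.simps)

lemma ell1_act: "ell1 x (act \<sigma> x) \<le> 1"
proof -
  have "ell1 x (act \<sigma> x) \<le> (\<Sum>j\<in>UNIV. of_bool (\<sigma> = Inc j \<or> \<sigma> = Dec j))"
    unfolding ell1_def
    by (cases \<sigma>; intro sum_mono; simp add: act_nth del: act.simps split: nat_diff_split)
  also have "\<dots> \<le> (1::real)"
    by (cases \<sigma>) (simp_all add: of_bool_def)
  finally show ?thesis .
qed

text \<open>One step of a shortest path. The chosen move is never blocked: a decrease is made only
  where the coordinate of \<open>x\<close> exceeds that of \<open>y\<close>.\<close>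

lemma move_towards:
  assumes "x \<noteq> y"
  obtains \<sigma> where "act \<sigma> x \<noteq> x" "ell1 (act \<sigma> x) y = ell1 x y - 1"
proof -
  from assms obtain i where i: "x $ i \<noteq> y $ i" by (auto simp: vec_eq_iff)
  define \<sigma> where "\<sigma> = (if x $ i < y $ i then Inc i else Dec i)"
  have *: "\<bar>real (act \<sigma> x $ j) - real (y $ j)\<bar> = \<bar>real (x $ j) - real (y $ j)\<bar> - of_bool (i = j)" for j
    using i by (auto simp: \<sigma>_def act_nth simp del: act.simps)
  have "ell1 (act \<sigma> x) y = ell1 x y - 1"
    unfolding ell1_def * by (simp add: sum_subtractf of_bool_def)
  moreover from this have "act \<sigma> x \<noteq> x" by auto
  ultimately show ?thesis using that by blast
qed

lemma adjacent_move:
  assumes "x \<noteq> y" "ell1 x y \<le> 1"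
  obtains \<sigma> where "act \<sigma> x = y"
proof -
  obtain \<sigma> where "ell1 (act \<sigma> x) y = ell1 x y - 1" using move_towards[OF assms(1)] .
  with assms(2) have "ell1 (act \<sigma> x) y = 0" using ell1_nonneg[of "act \<sigma> x" y] by linarith
  then show ?thesis using that by simp
qed

section \<open>Curvature of an oriented edge and the coupled rates\<close>

definition move_curvature :: "'d::finite rates \<Rightarrow> 'd state \<Rightarrow> 'd move \<Rightarrow> real" where
  "move_curvature c x \<sigma> = c x \<sigma> - c (act \<sigma> x) \<sigma>
     - (\<Sum>\<gamma>\<in>UNIV - {\<sigma>, inv_move \<sigma>}. max (c (act \<sigma> x) \<gamma> - c x \<gamma>) 0)"

lemma kappa_plus_eq: "kappa_plus c x i = move_curvature c x (Inc i)"
  by (simp add: kappa_plus_def move_curvature_def grad_def del: act.simps)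

text \<open>The same edge seen from its upper end. Reversing the orientation flips the sign of all
  differences of rates, which accounts for the different shapes of the two formulas.\<close>

lemma kappa_minus_eq: "kappa_minus c x i = move_curvature c (act (Inc i) x) (Dec i)"
proof -
  have "act (Dec i) (act (Inc i) x) = x" using act_inv_move[OF act_Inc_neq, of i x] by simp
  then show ?thesis
    by (simp add: kappa_minus_def move_curvature_def grad_def insert_commute del: act.simps)
qed

fun act_opt :: "'d::finite move option \<Rightarrow> 'd state \<Rightarrow> 'd state" where
  "act_opt None x = x"
| "act_opt (Some \<sigma>) x = act \<sigma> x"

text \<open>\<open>None\<close> means that a component stays where it is. The pair
  \<open>(None, None)\<close> gets rate 0, so every ring uses a move of at least one component; the
  non-explosion estimate relies on this.\<close>

definition rate_coupling ::
    "'d::finite rates \<Rightarrow> 'd state \<Rightarrow> 'd state \<Rightarrow> ('d move option \<times> 'd move option \<Rightarrow> real) \<Rightarrow> bool" where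
  "rate_coupling c x y \<rho> \<longleftrightarrow>
     (\<forall>k. 0 \<le> \<rho> k) \<and> \<rho> (None, None) = 0 \<and>
     (\<forall>\<sigma>. (\<Sum>\<tau>\<in>UNIV. \<rho> (Some \<sigma>, \<tau>)) = c x \<sigma>) \<and> (\<forall>\<tau>. (\<Sum>\<sigma>\<in>UNIV. \<rho> (\<sigma>, Some \<tau>)) = c y \<tau>)"

lemma sum_UNIV_option:
  fixes f :: "'a::finite option \<Rightarrow> 'b::comm_monoid_add"
  shows "(\<Sum>\<tau>\<in>UNIV. f \<tau>) = f None + (\<Sum>\<tau>\<in>UNIV. f (Some \<tau>))"
  unfolding UNIV_option_conv by (simp add: sum.reindex)

lemma sum_UNIV_move_remove:
  fixes f :: "'d::finite move \<Rightarrow> real"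
  shows "(\<Sum>\<gamma>\<in>UNIV. f \<gamma>) = f \<sigma> + f (inv_move \<sigma>) + (\<Sum>\<gamma>\<in>UNIV - {\<sigma>, inv_move \<sigma>}. f \<gamma>)"
proof -
  have "UNIV - {\<sigma>} - {inv_move \<sigma>} = UNIV - {\<sigma>, inv_move \<sigma>}" by auto
  then show ?thesis
    by (simp add: sum.remove[of UNIV \<sigma> f] sum.remove[of "UNIV - {\<sigma>}" "inv_move \<sigma>" f])
qed

text \<open>
  The chains at \<open>x\<close> and \<open>y = act \<sigma> x\<close> make the same move whenever possible.  The
  excess rate of a move \<open>\<gamma>\<close> at \<open>y\<close> is matched with the move \<open>\<sigma>\<close> of the first
  chain, and the excess rate at \<open>x\<close> with the move \<open>inv_move \<sigma>\<close> of the second one.  The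
  rates of these two moves that remain, which lead to coalescence, are the two curvatures.
\<close>

fun adjacent_rates ::
    "'d::finite rates \<Rightarrow> 'd state \<Rightarrow> 'd move \<Rightarrow> 'd move option \<times> 'd move option \<Rightarrow> real" where
  "adjacent_rates c x \<sigma> (None, None) = 0"
| "adjacent_rates c x \<sigma> (Some \<gamma>, None) = (if \<gamma> = \<sigma> then move_curvature c x \<sigma> else 0)"
| "adjacent_rates c x \<sigma> (None, Some \<gamma>) =
     (if \<gamma> = inv_move \<sigma> then move_curvature c (act \<sigma> x) (inv_move \<sigma>) else 0)"
| "adjacent_rates c x \<sigma> (Some \<gamma>, Some \<gamma>') =
     (if \<gamma> = \<gamma>' then
        if \<gamma> = \<sigma> then c (act \<sigma> x) \<sigma>
        else if \<gamma> = inv_move \<sigma> then c x (inv_move \<sigma>)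
        else min (c x \<gamma>) (c (act \<sigma> x) \<gamma>)
      else if \<gamma> = \<sigma> \<and> \<gamma>' \<noteq> inv_move \<sigma> then max (c (act \<sigma> x) \<gamma>' - c x \<gamma>') 0
      else if \<gamma> \<noteq> \<sigma> \<and> \<gamma>' = inv_move \<sigma> then max (c x \<gamma> - c (act \<sigma> x) \<gamma>) 0
      else 0)"

text \<open>Reversing the edge transposes the table of rates, so the second marginal follows from
  the first.\<close>

lemma adjacent_rates_swap:
  assumes "act \<sigma> x \<noteq> x"
  shows "adjacent_rates c (act \<sigma> x) (inv_move \<sigma>) (b, a) = adjacent_rates c x \<sigma> (a, b)"
  by (cases a; cases b) (auto simp: act_inv_move[OF assms] min.commute)

text \<open>Bookkeeping that is valid for any signs. In row \<sigma> the curvature is by definition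
  what remains after the joint move and the matched excesses; in row
  \<open>inv_move \<sigma>\<close> the whole rate is on the diagonal; in the other rows a minimum
  and a positive part add up to the rate at \<open>x\<close>.\<close>

lemma adjacent_rates_marginal:
  "(\<Sum>\<tau>\<in>UNIV. adjacent_rates c x \<sigma> (Some \<gamma>, \<tau>)) = c x \<gamma>"
proof -
  let ?f = "\<lambda>\<tau>. adjacent_rates c x \<sigma> (Some \<gamma>, Some \<tau>)"
  let ?O = "UNIV - {\<sigma>, inv_move \<sigma>}"
  have "(\<Sum>\<tau>\<in>UNIV. adjacent_rates c x \<sigma> (Some \<gamma>, \<tau>)) =
      adjacent_rates c x \<sigma> (Some \<gamma>, None) + (?f \<sigma> + ?f (inv_move \<sigma>) + sum ?f ?O)"
    by (subst sum_UNIV_option) (rule arg_cong[where f = "(+) _", OF sum_UNIV_move_remove])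
  also have "\<dots> = c x \<gamma>"
  proof -
    consider "\<gamma> = \<sigma>" | "\<gamma> = inv_move \<sigma>" | "\<gamma> \<noteq> \<sigma>" "\<gamma> \<noteq> inv_move \<sigma>" by blast
    then show ?thesis
    proof cases
      case 1
      have "sum ?f ?O = (\<Sum>\<tau>\<in>?O. max (c (act \<sigma> x) \<tau> - c x \<tau>) 0)"
        using 1 by (intro sum.cong) auto
      then show ?thesis using 1 by (simp add: move_curvature_def)
    next
      case 2
      have "sum ?f ?O = (\<Sum>\<tau>\<in>?O. 0)"
        using 2 by (intro sum.cong) auto
      then show ?thesis using 2 by simp
    next
      case 3
      have "sum ?f ?O = (\<Sum>\<tau>\<in>?O. if \<tau> = \<gamma> then min (c x \<gamma>) (c (act \<sigma> x) \<gamma>) else 0)"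
        using 3 by (intro sum.cong) auto
      also have "\<dots> = min (c x \<gamma>) (c (act \<sigma> x) \<gamma>)" using 3 by simp
      finally show ?thesis using 3 by simp
    qed
  qed
  finally show ?thesis .
qed

lemma rate_coupling_adjacent_rates:
  assumes c: "\<And>x \<sigma>. 0 \<le> c x \<sigma>"
    and curv: "\<And>x \<sigma>. act \<sigma> x \<noteq> x \<Longrightarrow> 0 \<le> move_curvature c x \<sigma>"
    and \<sigma>: "act \<sigma> x \<noteq> x"
  shows "rate_coupling c x (act \<sigma> x) (adjacent_rates c x \<sigma>)"
  unfolding rate_coupling_def
proof (intro conjI allI)
  fix k
  have "0 \<le> move_curvature c (act \<sigma> x) (inv_move \<sigma>)"
    using \<sigma> by (intro curv) (metis act_inv_move)
  then show "0 \<le> adjacent_rates c x \<sigma> k"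
    using c curv[OF \<sigma>] by (cases "(c, x, \<sigma>, k)" rule: adjacent_rates.cases) auto
next
  fix \<tau>
  show "(\<Sum>\<tau>'\<in>UNIV. adjacent_rates c x \<sigma> (\<tau>', Some \<tau>)) = c (act \<sigma> x) \<tau>"
    unfolding adjacent_rates_swap[OF \<sigma>, symmetric] by (rule adjacent_rates_marginal)
qed (simp_all add: adjacent_rates_marginal)

text \<open>Equal moves do not separate the chains. A matched excess sends one chain to the old
  position of the other while the other makes one step. An unmatched move makes them meet.\<close>

lemma adjacent_rates_adjacent:
  assumes "0 < adjacent_rates c x \<sigma> (a, b)" and \<sigma>: "act \<sigma> x \<noteq> x"
  shows "ell1 (act_opt a x) (act_opt b (act \<sigma> x)) \<le> 1"
proof -
  have [simp]: "act (inv_move \<sigma>) (act \<sigma> x) = x" by (rule act_inv_move[OF \<sigma>])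
  have *: "ell1 (act \<gamma> x) (act \<gamma> (act \<sigma> x)) \<le> 1" for \<gamma>
    by (rule order_trans[OF ell1_act_act ell1_act])
  have "ell1 (act \<gamma> x) x \<le> 1" for \<gamma>
    using ell1_act[of x \<gamma>] by (simp add: ell1_commute)
  then show ?thesis
    using assms * ell1_act[of "act \<sigma> x"]
    by (cases a; cases b) (auto split: if_splits simp del: act.simps)
qed

text \<open>The two unmatched moves, by which one chain jumps onto the other, contribute exactly the
  two curvatures; all remaining terms are nonnegative.\<close>

lemma adjacent_rates_coalescence:
  assumes c: "\<And>x \<sigma>. 0 \<le> c x \<sigma>"
    and curv: "\<And>x \<sigma>. act \<sigma> x \<noteq> x \<Longrightarrow> 0 \<le> move_curvature c x \<sigma>"
    and \<sigma>: "act \<sigma> x \<noteq> x"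
  shows "move_curvature c x \<sigma> + move_curvature c (act \<sigma> x) (inv_move \<sigma>) \<le>
    (\<Sum>k\<in>UNIV. adjacent_rates c x \<sigma> k * of_bool (act_opt (fst k) x = act_opt (snd k) (act \<sigma> x)))"
proof -
  let ?f = "\<lambda>k. adjacent_rates c x \<sigma> k * of_bool (act_opt (fst k) x = act_opt (snd k) (act \<sigma> x))"
  have "0 \<le> adjacent_rates c x \<sigma> k" for k
    using rate_coupling_adjacent_rates[OF assms] unfolding rate_coupling_def by blast
  then have "sum ?f {(Some \<sigma>, None), (None, Some (inv_move \<sigma>))} \<le> sum ?f UNIV"
    by (intro sum_mono2) auto
  then show ?thesis by (simp add: act_inv_move[OF \<sigma>] del: act.simps)
qed

lemma rate_coupling_diagonal:
  assumes c: "\<And>x \<sigma>. 0 \<le> c x \<sigma>"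
  shows "rate_coupling c x x (\<lambda>(a, b). if a = b then case a of None \<Rightarrow> 0 | Some \<sigma> \<Rightarrow> c x \<sigma> else 0)"
  using c by (auto simp: rate_coupling_def sum_UNIV_option split: option.splits)

lemma rate_coupling_independent:
  assumes c: "\<And>x \<sigma>. 0 \<le> c x \<sigma>"
  shows "rate_coupling c x y (\<lambda>(a, b). case a of
      None \<Rightarrow> (case b of None \<Rightarrow> 0 | Some \<tau> \<Rightarrow> c y \<tau>)
    | Some \<sigma> \<Rightarrow> (if b = None then c x \<sigma> else 0))"
  using c by (auto simp: rate_coupling_def sum_UNIV_option split: option.splits)

text \<open>Equal chains move together, neighbours use the table above, all other pairs move
  independently. The last choice is a default that defines the pair chain everywhere; chains started
  in neighbours never reach such pairs.\<close>

lemma contracting_rate_coupling: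
  assumes c: "\<And>x \<sigma>. 0 \<le> c x \<sigma>"
    and curv: "\<And>x \<sigma>. act \<sigma> x \<noteq> x \<Longrightarrow> 0 \<le> move_curvature c x \<sigma>"
    and \<kappa>: "\<And>x \<sigma>. act \<sigma> x \<noteq> x \<Longrightarrow>
      \<kappa> \<le> move_curvature c x \<sigma> + move_curvature c (act \<sigma> x) (inv_move \<sigma>)"
  obtains r where "\<And>x y. rate_coupling c x y (r (x, y))"
    "\<And>x y a b. ell1 x y \<le> 1 \<Longrightarrow> 0 < r (x, y) (a, b) \<Longrightarrow> ell1 (act_opt a x) (act_opt b y) \<le> 1"
    "\<And>x a b. 0 < r (x, x) (a, b) \<Longrightarrow> act_opt a x = act_opt b x"
    "\<And>x y. ell1 x y \<le> 1 \<Longrightarrow> x \<noteq> y \<Longrightarrow>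
      \<kappa> \<le> (\<Sum>k\<in>UNIV. r (x, y) k * of_bool (act_opt (fst k) x = act_opt (snd k) y))"
proof -
  let ?P = "\<lambda>x y \<rho>. rate_coupling c x y \<rho> \<and>
    (ell1 x y \<le> 1 \<longrightarrow> (\<forall>a b. 0 < \<rho> (a, b) \<longrightarrow> ell1 (act_opt a x) (act_opt b y) \<le> 1)) \<and>
    (x = y \<longrightarrow> (\<forall>a b. 0 < \<rho> (a, b) \<longrightarrow> act_opt a x = act_opt b x)) \<and>
    (ell1 x y \<le> 1 \<longrightarrow> x \<noteq> y \<longrightarrow>
      \<kappa> \<le> (\<Sum>k\<in>UNIV. \<rho> k * of_bool (act_opt (fst k) x = act_opt (snd k) y)))"
  have "\<exists>\<rho>. ?P x y \<rho>" for x y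
  proof -
    consider "x = y" | "x \<noteq> y" "ell1 x y \<le> 1" | "1 < ell1 x y" by fastforce
    then show ?thesis
    proof cases
      case 1
      then show ?thesis
        using rate_coupling_diagonal[of c x, OF c] by (intro exI) (auto split: if_splits)
    next
      case 2
      then obtain \<sigma> where \<sigma>: "act \<sigma> x = y" using adjacent_move by blast
      then have "act \<sigma> x \<noteq> x" using 2 by auto
      note * = this
      show ?thesis
        using rate_coupling_adjacent_rates[OF c curv *] adjacent_rates_adjacent[OF _ *]
          order_trans[OF \<kappa>[OF *] adjacent_rates_coalescence[OF c curv *]] 2(1)
        unfolding \<sigma> by (intro exI[of _ "adjacent_rates c x \<sigma>"]) auto
    next
      case 3
      then have "x \<noteq> y" by auto
      with 3 show ?thesis using rate_coupling_independent[of c x y, OF c] by (intro exI) auto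
    qed
  qed
  then have "\<forall>z. \<exists>\<rho>. ?P (fst z) (snd z) \<rho>" by blast
  from choice[OF this] obtain r where r: "\<And>z. ?P (fst z) (snd z) (r z)" by blast
  show ?thesis
  proof
    show "rate_coupling c x y (r (x, y))" for x y
      using r[of "(x, y)"] by simp
    show "ell1 (act_opt a x) (act_opt b y) \<le> 1" if "ell1 x y \<le> 1" "0 < r (x, y) (a, b)" for x y a b
      using r[of "(x, y)"] that by simp
    show "act_opt a x = act_opt b x" if "0 < r (x, x) (a, b)" for x a b
      using r[of "(x, x)"] that by simp
    show "\<kappa> \<le> (\<Sum>k\<in>UNIV. r (x, y) k * of_bool (act_opt (fst k) x = act_opt (snd k) y))"
      if "ell1 x y \<le> 1" "x \<noteq> y" for x y
      using r[of "(x, y)"] that by simp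
  qed
qed

section \<open>Coupling the chains\<close>

lemma transition_0:
  assumes c: "\<And>x \<sigma>. 0 \<le> c x \<sigma>"
  shows "enn2real (transition c 0 x y) = indicator {x} y"
  using transition_variation_of_constants(2)[of c 0 x y, OF c] by simp

lemma ennreal_enn2real_transition:
  assumes c: "\<And>x \<sigma>. 0 \<le> c x \<sigma>" and "0 \<le> t"
  shows "ennreal (enn2real (transition c t x y)) = transition c t x y"
  using transition_le_1[of c t x y, OF c] assms(2) by (simp add: order_le_less_trans)

text \<open>
  The clock at \<open>x\<close> may be run faster by any rate \<open>R\<close> if the additional rings are ignored.
  In a coupled chain these are the jumps of the other component alone.
\<close>

lemma transition_first_ring:
  fixes c :: "'d::finite rates" and x y :: "'d state"
  assumes c: "\<And>x \<sigma>. 0 \<le> c x \<sigma>" and t: "0 \<le> t" and R: "0 \<le> R"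
  defines "Q \<equiv> R + total_rate c x"
  shows "ennreal (exp (- Q * t)) * indicator {x} y +
     (\<integral>\<^sup>+ s\<in>{0..t}. (ennreal (exp (- Q * s) * R) * transition c (t - s) x y +
        (\<Sum>\<sigma>\<in>UNIV. ennreal (exp (- Q * s) * c x \<sigma>) * transition c (t - s) (act \<sigma> x) y)) \<partial>lborel)
    = transition c t x y" (is "_ + ?I = _")
proof -
  define p where "p z u = enn2real (transition c u z y)" for z u
  have p_meas [measurable]: "p z \<in> borel_measurable borel" for z
    unfolding p_def by measurable
  have p: "transition c u z y = ennreal (p z u)" if "0 \<le> u" for z u
    unfolding p_def by (rule ennreal_enn2real_transition[OF c that, symmetric])
  have p0: "0 \<le> p z u" for z u by (simp add: p_def)
  define \<phi> where "\<phi> s = exp (- Q * s) * (R * p x (t - s) + (\<Sum>\<sigma>\<in>UNIV. c x \<sigma> * p (act \<sigma> x) (t - s)))" for s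
  have \<phi>0: "0 \<le> \<phi> s" for s
    unfolding \<phi>_def using c R p0 by (intro mult_nonneg_nonneg add_nonneg_nonneg sum_nonneg) auto
  \<comment> \<open>An antiderivative of \<open>\<phi>\<close> by the backward equation: the
    exponential contributes Q times \<open>p x\<close>, the generator removes
    \<open>total_rate c x\<close> times it, and R times it remains. At s = t the chain is at time 0,
    where only continuity is available; hence the fundamental theorem with derivatives in the
    interior.\<close>
  let ?F = "\<lambda>s. - (exp (- Q * s) * p x (t - s))"
  have "(\<phi> has_integral (?F t - ?F 0)) {0..t}"
  proof (rule fundamental_theorem_of_calculus_interior[OF t])
    have "continuous_on {0..t} (p x \<circ> (\<lambda>s. t - s))"
      unfolding p_def by (intro continuous_on_compose continuous_on_subset[OF continuous_on_transition[of c t, OF c]])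
        (auto intro!: continuous_intros)
    then show "continuous_on {0..t} ?F"
      by (auto intro!: continuous_intros simp: o_def)
  next
    fix s assume s: "s \<in> {0<..<t}"
    let ?D = "generator c (\<lambda>z. p z (t - s)) x"
    have "(p x has_real_derivative ?D) (at (t - s))"
      unfolding p_def by (rule backward_equation[OF c]) (use s in auto)
    then have 1: "((\<lambda>s. p x (t - s)) has_real_derivative ?D * (- 1)) (at s)"
      by (rule DERIV_chain'[rotated]) (auto intro!: derivative_eq_intros)
    have 2: "((\<lambda>s. exp (- Q * s)) has_real_derivative exp (- Q * s) * (- Q)) (at s)"
      by (auto intro!: derivative_eq_intros)
    have "(?F has_real_derivative
        - (exp (- Q * s) * (- Q) * p x (t - s) + ?D * (- 1) * exp (- Q * s))) (at s)"
      by (intro DERIV_minus DERIV_mult 1 2)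
    moreover have "- (exp (- Q * s) * (- Q) * p x (t - s) + ?D * (- 1) * exp (- Q * s)) = \<phi> s"
      unfolding \<phi>_def generator_total_rate Q_def by (simp add: algebra_simps)
    ultimately show "(?F has_vector_derivative \<phi> s) (at s)"
      by (simp add: has_real_derivative_iff_has_vector_derivative)
  qed
  moreover have "(\<lambda>s. indicator {0..t} s * \<phi> s) = (\<lambda>s. if s \<in> {0..t} then \<phi> s else 0)"
    by (auto split: split_indicator)
  ultimately have *: "((\<lambda>s. indicator {0..t} s * \<phi> s) has_integral (?F t - ?F 0)) UNIV"
    by (simp only: has_integral_restrict_UNIV)
  have "?I = (\<integral>\<^sup>+ s. ennreal (indicator {0..t} s * \<phi> s) \<partial>lborel)"
  proof (rule nn_integral_cong)
    fix s
    show "(ennreal (exp (- Q * s) * R) * transition c (t - s) x y +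
        (\<Sum>\<sigma>\<in>UNIV. ennreal (exp (- Q * s) * c x \<sigma>) * transition c (t - s) (act \<sigma> x) y)) *
        indicator {0..t} s = ennreal (indicator {0..t} s * \<phi> s)"
    proof (cases "s \<in> {0..t}")
      case True
      let ?e = "exp (- Q * s)"
      have "(\<Sum>\<sigma>\<in>UNIV. ennreal (?e * c x \<sigma>) * transition c (t - s) (act \<sigma> x) y) =
          (\<Sum>\<sigma>\<in>UNIV. ennreal (?e * c x \<sigma> * p (act \<sigma> x) (t - s)))"
        using True c p0 by (intro sum.cong refl) (simp add: p ennreal_mult)
      also have "\<dots> = ennreal (\<Sum>\<sigma>\<in>UNIV. ?e * c x \<sigma> * p (act \<sigma> x) (t - s))"
        using c p0 by (intro sum_ennreal) simp
      finally have "ennreal (?e * R) * transition c (t - s) x y +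
          (\<Sum>\<sigma>\<in>UNIV. ennreal (?e * c x \<sigma>) * transition c (t - s) (act \<sigma> x) y) =
          ennreal (?e * R * p x (t - s)) + ennreal (\<Sum>\<sigma>\<in>UNIV. ?e * c x \<sigma> * p (act \<sigma> x) (t - s))"
        using True R p0 by (simp add: p ennreal_mult)
      also have "\<dots> = ennreal (?e * R * p x (t - s) + (\<Sum>\<sigma>\<in>UNIV. ?e * c x \<sigma> * p (act \<sigma> x) (t - s)))"
        using c R p0 by (intro ennreal_plus[symmetric] sum_nonneg mult_nonneg_nonneg) auto
      also have "?e * R * p x (t - s) + (\<Sum>\<sigma>\<in>UNIV. ?e * c x \<sigma> * p (act \<sigma> x) (t - s)) = \<phi> s"
        by (simp add: \<phi>_def distrib_left sum_distrib_left mult.assoc)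
      finally show ?thesis using True by simp
    qed simp
  qed
  also have "\<dots> = ennreal (?F t - ?F 0)"
    using \<phi>0 by (intro nn_integral_has_integral_lborel *) (auto simp: \<phi>_def)
  finally have I: "?I = ennreal (?F t - ?F 0)" .
  have "0 \<le> ?F t - ?F 0"
    by (rule has_integral_nonneg[OF *]) (simp add: \<phi>0)
  then have "ennreal (exp (- Q * t)) * indicator {x} y + ?I =
      ennreal (exp (- Q * t) * indicator {x} y + (?F t - ?F 0))"
    unfolding I by (subst ennreal_plus) (auto simp: ennreal_mult ennreal_indicator)
  also have "exp (- Q * t) * indicator {x} y + (?F t - ?F 0) = p x t"
    by (simp add: p_def transition_0[OF c])
  finally show ?thesis using t by (simp add: p)
qed

text \<open>For the projected chain a ring with \<open>f k = None\<close> is an ignored ring, so the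
  transition function of \<open>c\<close> solves the first-jump equation of the large chain.
  Minimality gives only an inequality, since the large chain might still lose mass.\<close>

lemma jump_upto_marginal_le:
  fixes c :: "'d::finite rates" and f :: "'k::finite \<Rightarrow> 'd move option"
  assumes c: "\<And>x \<sigma>. 0 \<le> c x \<sigma>" and r: "\<And>z k. 0 \<le> r z k"
    and proj: "\<And>z k. g (a k z) = act_opt (f k) (g z)"
    and rate: "\<And>z \<sigma>. (\<Sum>k | f k = Some \<sigma>. r z k) = c (g z) \<sigma>"
    and t: "0 \<le> t"
  shows "jump_upto a r (\<lambda>z. indicator {y} (g z)) n t z \<le> transition c t (g z) y"
proof (rule jump_upto_le_supersolution[where S = UNIV and H = "\<lambda>t z. transition c t (g z) y"])
  fix t :: real and z
  assume t: "0 \<le> t"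
  define R where "R = (\<Sum>k | f k = None. r z k)"
  have group: "(\<Sum>k\<in>UNIV. h k) = (\<Sum>k | f k = None. h k) + (\<Sum>\<sigma>\<in>UNIV. \<Sum>k | f k = Some \<sigma>. h k)"
    for h :: "'k \<Rightarrow> 'b::comm_monoid_add"
    using sum.group[of UNIV UNIV f h] by (simp add: sum_UNIV_option)
  have Q: "exit_rate r z = R + total_rate c (g z)"
    unfolding exit_rate_def total_rate_def R_def by (subst group) (simp add: rate)
  have part: "(\<Sum>k | f k = \<sigma>. ennreal (e * r z k) * transition c u (g (a k z)) y) =
      ennreal (e * (\<Sum>k | f k = \<sigma>. r z k)) * transition c u (act_opt \<sigma> (g z)) y"
    if "0 \<le> e" for e u \<sigma>
  proof -
    have "(\<Sum>k | f k = \<sigma>. ennreal (e * r z k) * transition c u (g (a k z)) y) =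
        (\<Sum>k | f k = \<sigma>. ennreal (e * r z k)) * transition c u (act_opt \<sigma> (g z)) y"
      unfolding sum_distrib_right by (intro sum.cong) (auto simp: proj)
    then show ?thesis using that r by (simp add: sum_ennreal sum_distrib_left)
  qed
  have "(\<Sum>k\<in>UNIV. ennreal (exp (- exit_rate r z * s) * r z k) * transition c (t - s) (g (a k z)) y) =
      ennreal (exp (- (R + total_rate c (g z)) * s) * R) * transition c (t - s) (g z) y +
      (\<Sum>\<sigma>\<in>UNIV. ennreal (exp (- (R + total_rate c (g z)) * s) * c (g z) \<sigma>) *
         transition c (t - s) (act \<sigma> (g z)) y)" for s
    unfolding Q by (subst group) (simp only: part[OF exp_ge_zero] rate R_def[symmetric] act_opt.simps)
  moreover have "(indicator {y} (g z) :: ennreal) = indicator {g z} y"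
    by (auto simp: indicator_def)
  moreover have "0 \<le> R" unfolding R_def by (intro sum_nonneg r)
  ultimately show "ennreal (exp (- exit_rate r z * t)) * indicator {y} (g z) +
      (\<integral>\<^sup>+ s\<in>{0..t}. (\<Sum>k\<in>UNIV. ennreal (exp (- exit_rate r z * s) * r z k) *
        transition c (t - s) (g (a k z)) y) \<partial>lborel) \<le> transition c t (g z) y"
    using transition_first_ring[of c t R "g z" y, OF c t] by (simp only: Q order_refl)
qed (use assms in auto)

section \<open>Non-explosion of the pair chain\<close>

definition state_total :: "'d::finite state \<Rightarrow> nat" where
  "state_total x = (\<Sum>i\<in>UNIV. x $ i)"

lemma state_total_act_Inc: "state_total (act (Inc i) x) = state_total x + 1"
  by (simp add: state_total_def act_nth sum.distrib of_bool_def del: act.simps)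

lemma state_total_act_Dec:
  assumes "x $ i > 0"
  shows "state_total x = state_total (act (Dec i) x) + 1"
proof -
  have "act (Inc i) (act (Dec i) x) = x"
    using assms act_inv_move[of "Dec i" x] by (auto simp: vec_eq_iff axis_def split: if_splits)
  then show ?thesis using state_total_act_Inc[of i "act (Dec i) x"] by simp
qed

lemma state_total_act_opt: "state_total (act_opt a x) \<le> state_total x + 1"
proof -
  have "state_total (act (Dec i) x) \<le> state_total x" for i
    unfolding state_total_def by (intro sum_mono) (simp add: act_nth del: act.simps)
  then have "state_total (act \<sigma> x) \<le> state_total x + 1" for \<sigma>
    by (cases \<sigma>) (simp_all add: state_total_act_Inc le_SucI del: act.simps)
  then show ?thesis by (cases a) simp_all
qed

definition act_pair ::
    "'d::finite move option \<times> 'd move option \<Rightarrow> 'd state \<times> 'd state \<Rightarrow> 'd state \<times> 'd state" where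
  "act_pair k z = (act_opt (fst k) (fst z), act_opt (snd k) (snd z))"

lemma sum_fst_eq: "(\<Sum>k | fst k = a. h k) = (\<Sum>b\<in>UNIV. h (a, b))"
  for h :: "'a::finite \<times> 'b::finite \<Rightarrow> 'c::comm_monoid_add"
proof -
  have "{k :: 'a \<times> 'b. fst k = a} = Pair a ` UNIV" by auto
  then show ?thesis by (simp add: sum.reindex inj_on_def)
qed

lemma sum_snd_eq: "(\<Sum>k | snd k = b. h k) = (\<Sum>a\<in>UNIV. h (a, b))"
  for h :: "'a::finite \<times> 'b::finite \<Rightarrow> 'c::comm_monoid_add"
proof -
  have "{k :: 'a \<times> 'b. snd k = b} = (\<lambda>a. (a, b)) ` UNIV" by auto
  then show ?thesis by (simp add: sum.reindex inj_on_def)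
qed

text \<open>
  Moves in which some component goes up have bounded total rate; all others lower
  \<open>state_total x + state_total y\<close>.
\<close>

lemma coupled_drift:
  fixes C :: real and c :: "'d::finite rates"
    and r :: "'d state \<times> 'd state \<Rightarrow> 'd move option \<times> 'd move option \<Rightarrow> real"
  assumes Dec: "\<And>x i. x $ i = 0 \<Longrightarrow> c x (Dec i) = 0"
    and Inc: "\<And>x i. c x (Inc i) \<le> C"
    and rc: "\<And>x y. rate_coupling c x y (r (x, y))"
  defines "h \<equiv> \<lambda>z. 2 ^ (state_total (fst z) + state_total (snd z)) :: real"
  shows "(\<Sum>k\<in>UNIV. r z k * h (act_pair k z)) \<le> 1 / 2 * (exit_rate r z + 16 * CARD('d) * C) * h z"
proof -
  obtain x y where z: "z = (x, y)" by fastforce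
  let ?r = "r (x, y)"
  let ?b1 = "\<lambda>i k. of_bool (fst k = Some (Inc i)) :: real"
  let ?b2 = "\<lambda>i k. of_bool (snd k = Some (Inc i)) :: real"
  let ?u = "\<lambda>k. \<Sum>i\<in>UNIV. ?b1 i k + ?b2 i k"
  have r0: "0 \<le> ?r k" and rN: "?r (None, None) = 0"
    and m1: "(\<Sum>\<tau>\<in>UNIV. ?r (Some \<sigma>, \<tau>)) = c x \<sigma>"
    and m2: "(\<Sum>\<sigma>'\<in>UNIV. ?r (\<sigma>', Some \<tau>)) = c y \<tau>" for k \<sigma> \<tau>
    using rc[of x y] unfolding rate_coupling_def by blast+
  have h0: "0 < h z" for z by (simp add: h_def)
  have u0: "0 \<le> ?u k" for k by (intro sum_nonneg) auto
  \<comment> \<open>A ring that raises some component has \<open>?u k\<close> at least 1 and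
    multiplies \<open>h\<close> by at most 4. Any other ring of positive rate lowers the combined
    total by at least 1, hence at least halves \<open>h\<close>.\<close>
  have step: "?r k * h (act_pair k z) \<le> ?r k * ((1 / 2 + 4 * ?u k) * h z)" for k
  proof (cases "?r k = 0")
    case False
    with r0[of k] have pos: "0 < ?r k" by simp
    obtain a b where k: "k = (a, b)" by fastforce
    have "?r (a, b) \<le> c x \<sigma>" if "a = Some \<sigma>" for \<sigma>
      unfolding that m1[symmetric] by (rule member_le_sum) (use r0 in auto)
    then have ca: "0 < c x \<sigma>" if "a = Some \<sigma>" for \<sigma>
      using that pos k by (metis order_less_le_trans)
    have "?r (a, b) \<le> c y \<tau>" if "b = Some \<tau>" for \<tau>
      unfolding that m2[symmetric] by (rule member_le_sum[of a UNIV "\<lambda>a. ?r (a, Some \<tau>)"]) (use r0 in auto)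
    then have cb: "0 < c y \<tau>" if "b = Some \<tau>" for \<tau>
      using that pos k by (metis order_less_le_trans)
    have "h (act_pair k z) \<le> (1 / 2 + 4 * ?u k) * h z"
    proof (cases "\<exists>i. a = Some (Inc i) \<or> b = Some (Inc i)")
      case True
      then obtain i where "a = Some (Inc i) \<or> b = Some (Inc i)" ..
      then have "1 \<le> ?b1 i k + ?b2 i k" by (auto simp: k)
      also have "\<dots> \<le> ?u k" by (rule member_le_sum) auto
      finally have u: "1 \<le> ?u k" .
      have "h (act_pair k z) \<le> 2 ^ ((state_total x + 1) + (state_total y + 1))"
        unfolding h_def act_pair_def z k
        unfolding fst_conv snd_conv by (intro power_increasing add_mono state_total_act_opt) auto
      also have "\<dots> = 4 * h z" by (simp add: h_def z)
      also have "\<dots> \<le> (1 / 2 + 4 * ?u k) * h z" using u h0[of z] by (intro mult_right_mono) auto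
      finally show ?thesis .
    next
      case False
      then have a: "a = None \<or> (\<exists>i. a = Some (Dec i))" and b: "b = None \<or> (\<exists>i. b = Some (Dec i))"
        by (metis move.exhaust option.exhaust)+
      have a1: "state_total (act_opt a x) + 1 \<le> state_total x" if "a \<noteq> None"
      proof -
        from a that obtain i where i: "a = Some (Dec i)" by blast
        then have pos_i: "0 < x $ i" using ca[OF i] Dec[of x i] by (cases "x $ i") auto
        show ?thesis unfolding i act_opt.simps using state_total_act_Dec[OF pos_i] by linarith
      qed
      have b1: "state_total (act_opt b y) + 1 \<le> state_total y" if "b \<noteq> None"
      proof -
        from b that obtain i where i: "b = Some (Dec i)" by blast
        then have pos_i: "0 < y $ i" using cb[OF i] Dec[of y i] by (cases "y $ i") auto
        show ?thesis unfolding i act_opt.simps using state_total_act_Dec[OF pos_i] by linarith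
      qed
      have "a \<noteq> None \<or> b \<noteq> None" using pos rN k by (cases a; cases b) auto
      then have "state_total (act_opt a x) + state_total (act_opt b y) + 1 \<le> state_total x + state_total y"
      proof
        assume "a \<noteq> None"
        moreover have "state_total (act_opt b y) \<le> state_total y" using b1 by (cases "b = None") auto
        ultimately show ?thesis using a1 by linarith
      next
        assume "b \<noteq> None"
        moreover have "state_total (act_opt a x) \<le> state_total x" using a1 by (cases "a = None") auto
        ultimately show ?thesis using b1 by linarith
      qed
      then have "2 * h (act_pair k z) \<le> h z"
        unfolding h_def act_pair_def z k power_Suc[symmetric] by (intro power_increasing) auto
      moreover have "0 \<le> 4 * ?u k * h z" using u0[of k] h0[of z] by (intro mult_nonneg_nonneg) auto
      ultimately show ?thesis by (simp only: distrib_right)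
    qed
    then show ?thesis using r0 by (intro mult_left_mono)
  qed simp
  \<comment> \<open>Every increase is counted with its marginal rate, however it is matched in the
    other component.\<close>
  have "(\<Sum>k\<in>UNIV. ?r k * ?u k) = (\<Sum>i\<in>UNIV. (\<Sum>k\<in>UNIV. ?r k * ?b1 i k) + (\<Sum>k\<in>UNIV. ?r k * ?b2 i k))"
    unfolding sum_distrib_left sum.distrib[symmetric] distrib_left by (rule sum.swap)
  also have "\<dots> = (\<Sum>i\<in>UNIV. c x (Inc i) + c y (Inc i))"
  proof (intro sum.cong refl arg_cong2[where f = "(+)"])
    fix i
    show "(\<Sum>k\<in>UNIV. ?r k * ?b1 i k) = c x (Inc i)"
      using sum_fst_eq[of ?r "Some (Inc i)"]
      by (simp add: m1 of_bool_def if_distrib sum.If_cases cong: if_cong)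
    show "(\<Sum>k\<in>UNIV. ?r k * ?b2 i k) = c y (Inc i)"
      using sum_snd_eq[of ?r "Some (Inc i)"]
      by (simp add: m2 of_bool_def if_distrib sum.If_cases cong: if_cong)
  qed
  also have "\<dots> \<le> (\<Sum>i\<in>(UNIV::'d set). C + C)" by (intro sum_mono add_mono Inc)
  finally have up: "(\<Sum>k\<in>UNIV. ?r k * ?u k) \<le> 2 * CARD('d) * C" by simp
  have "(\<Sum>k\<in>UNIV. ?r k * h (act_pair k z)) \<le> (\<Sum>k\<in>UNIV. ?r k * ((1 / 2 + 4 * ?u k) * h z))"
    by (intro sum_mono step)
  also have "\<dots> = (\<Sum>k\<in>UNIV. (1 / 2 * ?r k + 4 * (?r k * ?u k)) * h z)"
    by (intro sum.cong refl) (simp only: distrib_left distrib_right mult_ac)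
  also have "\<dots> = (1 / 2 * (\<Sum>k\<in>UNIV. ?r k) + 4 * (\<Sum>k\<in>UNIV. ?r k * ?u k)) * h z"
    unfolding sum_distrib_right[symmetric] sum.distrib sum_distrib_left[symmetric] ..
  \<comment> \<open>Origin of the constant 16: increases of both chains have total rate at most 2
    \<open>CARD('d)\<close> C, the factor 4 makes this 8 \<open>CARD('d)\<close> C, and 1/2 is
    factored out.\<close>
  also have "\<dots> \<le> (1 / 2 * (\<Sum>k\<in>UNIV. ?r k) + 4 * (2 * CARD('d) * C)) * h z"
    using up h0[of z] by (intro mult_right_mono add_left_mono mult_left_mono) auto
  also have "\<dots> = 1 / 2 * (exit_rate r z + 16 * CARD('d) * C) * h z"
    by (simp add: exit_rate_def z field_simps)
  finally show ?thesis by (simp add: z)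
qed

section \<open>Coupled laws of chains started in neighbours\<close>

lemma law_at_return:
  assumes c: "\<And>x \<sigma>. 0 \<le> c x \<sigma>" and irr: "property_Irr c m" and t: "0 < t"
  shows "ennreal (pmf (law_at c (return_pmf x) t) y) = transition c t x y"
  unfolding pmf_law_at[OF c irr t] by (simp add: law_mass_def)

lemma law_at_bind:
  assumes c: "\<And>x \<sigma>. 0 \<le> c x \<sigma>" and irr: "property_Irr c m" and t: "0 < t"
  shows "law_at c \<mu> t = bind_pmf \<mu> (\<lambda>x. law_at c (return_pmf x) t)"
proof (rule pmf_eqI)
  fix y
  have "ennreal (pmf (law_at c \<mu> t) y) = (\<integral>\<^sup>+ x. ennreal (pmf (law_at c (return_pmf x) t) y) \<partial>\<mu>)"
    unfolding pmf_law_at[OF c irr t, of \<mu>] law_at_return[OF c irr t] law_mass_def ..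
  then show "pmf (law_at c \<mu> t) y = pmf (bind_pmf \<mu> (\<lambda>x. law_at c (return_pmf x) t)) y"
    by (simp flip: ennreal_pmf_bind)
qed

text \<open>Since both masses are 1, no inequality can be strict. This upgrades domination of
  marginals to equality.\<close>

lemma pmf_eqI_le:
  assumes "\<And>x. pmf p x \<le> pmf q x"
  shows "p = q"
proof (rule ccontr)
  assume "p \<noteq> q"
  then obtain x where "pmf q x < pmf p x" using pmf_neq_exists_less[of q p] by auto
  with assms[of x] show False by simp
qed

text \<open>All claims concern a single law of the pair chain, tested with the constant 1, the point
  indicators of a component, the indicator of pairs at distance above 1, and the distance
  itself.\<close>

lemma adjacent_coupling:
  fixes c :: "'d::finite rates" and \<kappa> C :: real
  assumes c: "\<And>x \<sigma>. 0 \<le> c x \<sigma>" and irr: "property_Irr c m" and t: "0 < t"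
    and Dec: "\<And>x i. x $ i = 0 \<Longrightarrow> c x (Dec i) = 0"
    and Inc: "\<And>x i. c x (Inc i) \<le> C"
    and curv: "\<And>x \<sigma>. act \<sigma> x \<noteq> x \<Longrightarrow> 0 \<le> move_curvature c x \<sigma>"
    and \<kappa>: "\<And>x \<sigma>. act \<sigma> x \<noteq> x \<Longrightarrow>
      \<kappa> \<le> move_curvature c x \<sigma> + move_curvature c (act \<sigma> x) (inv_move \<sigma>)"
    and xy: "ell1 x y \<le> 1"
  shows "\<exists>\<pi>\<in>couplings (law_at c (return_pmf x) t) (law_at c (return_pmf y) t).
    (\<forall>z\<in>set_pmf \<pi>. ell1 (fst z) (snd z) \<le> 1) \<and>
    (\<integral>\<^sup>+ z. ennreal (ell1 (fst z) (snd z)) \<partial>\<pi>) \<le> ennreal (exp (- \<kappa> * t) * ell1 x y)"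
proof -
  obtain r where rc: "\<And>x y. rate_coupling c x y (r (x, y))"
    and adj: "\<And>x y a b. ell1 x y \<le> 1 \<Longrightarrow> 0 < r (x, y) (a, b) \<Longrightarrow> ell1 (act_opt a x) (act_opt b y) \<le> 1"
    and diag: "\<And>x a b. 0 < r (x, x) (a, b) \<Longrightarrow> act_opt a x = act_opt b x"
    and coal: "\<And>x y. ell1 x y \<le> 1 \<Longrightarrow> x \<noteq> y \<Longrightarrow>
      \<kappa> \<le> (\<Sum>k\<in>UNIV. r (x, y) k * of_bool (act_opt (fst k) x = act_opt (snd k) y))"
    by (rule contracting_rate_coupling[of c \<kappa>])
       (rule c | erule curv | erule \<kappa> | (rule that; assumption))+
  have r: "0 \<le> r z k" for z k
    using rc[of "fst z" "snd z"] by (cases k) (simp add: rate_coupling_def)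
  have m1: "(\<Sum>k | fst k = Some \<sigma>. r z k) = c (fst z) \<sigma>"
    and m2: "(\<Sum>k | snd k = Some \<sigma>. r z k) = c (snd z) \<sigma>" for z \<sigma>
    using rc[of "fst z" "snd z"] by (simp_all add: sum_fst_eq sum_snd_eq rate_coupling_def)
  have t0: "0 \<le> t" using t by simp
  have "0 \<le> C" using order_trans[OF c Inc] .
  then have C: "0 \<le> 16 * CARD('d) * C" by simp
  let ?w = "\<lambda>z :: 'd state \<times> 'd state. 2 ^ (state_total (fst z) + state_total (snd z)) :: real"
  have drift: "(\<Sum>k\<in>UNIV. r z k * ?w (act_pair k z)) \<le>
      1 / 2 * (exit_rate r z + 16 * CARD('d) * C) * ?w z" for z
    by (rule coupled_drift[of c C r]) (erule Dec | rule Inc rc)+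
  have "(SUP n. jump_upto act_pair r (\<lambda>_. 1) n t (x, y)) = 1"
    by (rule jump_upto_mass[OF r _ _ _ C drift t0]) simp_all
  then obtain \<pi> where
    \<pi>: "\<And>g. (\<integral>\<^sup>+ w. g w \<partial>measure_pmf \<pi>) = (SUP n. jump_upto act_pair r g n t (x, y))"
    by (rule jump_upto_pmf) blast
  have le: "(\<integral>\<^sup>+ w. g w \<partial>measure_pmf \<pi>) \<le> b"
    if "\<And>n. jump_upto act_pair r g n t (x, y) \<le> b" for g b
    unfolding \<pi> using that by (rule SUP_least)
  let ?S = "{z. ell1 (fst z) (snd z) \<le> 1}"
  have closed: "act_pair k z \<in> ?S" if "z \<in> ?S" "r z k > 0" for z k
    using adj[of "fst z" "snd z" "fst k" "snd k"] that by (simp add: act_pair_def)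
  have "map_pmf fst \<pi> = law_at c (return_pmf x) t"
  proof (rule pmf_eqI_le)
    fix a
    have "ennreal (pmf (map_pmf fst \<pi>) a) = (\<integral>\<^sup>+ w. indicator {a} (fst w) \<partial>measure_pmf \<pi>)"
      by (simp add: ennreal_pmf_map nn_integral_indicator[symmetric] indicator_def vimage_def)
    also have "\<dots> \<le> transition c t x a"
    proof (rule le)
      fix n
      have "jump_upto act_pair r (\<lambda>z. indicator {a} (fst z)) n t (x, y) \<le> transition c t (fst (x, y)) a"
        by (rule jump_upto_marginal_le[where f = fst and g = fst and c = c and r = r, OF c r _ m1 t0])
           (simp add: act_pair_def)
      then show "jump_upto act_pair r (\<lambda>z. indicator {a} (fst z)) n t (x, y) \<le> transition c t x a"
        by simp
    qed
    finally show "pmf (map_pmf fst \<pi>) a \<le> pmf (law_at c (return_pmf x) t) a"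
      by (simp flip: law_at_return[OF c irr t])
  qed
  moreover have "map_pmf snd \<pi> = law_at c (return_pmf y) t"
  proof (rule pmf_eqI_le)
    fix a
    have "ennreal (pmf (map_pmf snd \<pi>) a) = (\<integral>\<^sup>+ w. indicator {a} (snd w) \<partial>measure_pmf \<pi>)"
      by (simp add: ennreal_pmf_map nn_integral_indicator[symmetric] indicator_def vimage_def)
    also have "\<dots> \<le> transition c t y a"
    proof (rule le)
      fix n
      have "jump_upto act_pair r (\<lambda>z. indicator {a} (snd z)) n t (x, y) \<le> transition c t (snd (x, y)) a"
        by (rule jump_upto_marginal_le[where f = snd and g = snd and c = c and r = r, OF c r _ m2 t0])
           (simp add: act_pair_def)
      then show "jump_upto act_pair r (\<lambda>z. indicator {a} (snd z)) n t (x, y) \<le> transition c t y a"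
        by simp
    qed
    finally show "pmf (map_pmf snd \<pi>) a \<le> pmf (law_at c (return_pmf y) t) a"
      by (simp flip: law_at_return[OF c irr t])
  qed
  moreover have "\<forall>z\<in>set_pmf \<pi>. ell1 (fst z) (snd z) \<le> 1"
  proof -
    \<comment> \<open>The growth bound with rate 0: the drift of this indicator vanishes on
      \<open>?S\<close> because \<open>?S\<close> is closed under rings of positive rate.\<close>
    let ?h = "\<lambda>z. of_bool (1 < ell1 (fst z) (snd z)) :: real"
    have h: "(\<Sum>k\<in>UNIV. r z k * ?h (act_pair k z)) \<le> (exit_rate r z + 0) * ?h z" if "z \<in> ?S" for z
    proof -
      have "r z k * ?h (act_pair k z) = 0" for k
        using closed[OF that, of k] r[of z k] by (cases "r z k = 0") auto
      then have 0: "(\<Sum>k\<in>UNIV. r z k * ?h (act_pair k z)) = 0" by (intro sum.neutral) blast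
      show ?thesis unfolding 0 using that by simp
    qed
    have "(\<integral>\<^sup>+ z. ennreal (?h z) \<partial>\<pi>) \<le> ennreal (exp (0 * t) * ?h (x, y))"
      by (rule le, rule jump_upto_le_exp[where a = act_pair and r = r and S = ?S and h = ?h,
            OF r closed _ h _ t0]) (use xy in auto)
    then have "(\<integral>\<^sup>+ z. ennreal (?h z) \<partial>\<pi>) = 0" using xy by simp
    then show ?thesis by (force simp: nn_integral_0_iff_AE AE_measure_pmf_iff)
  qed
  moreover have "(\<integral>\<^sup>+ z. ennreal (ell1 (fst z) (snd z)) \<partial>\<pi>) \<le> ennreal (exp (- \<kappa> * t) * ell1 x y)"
  proof -
    let ?h = "\<lambda>z. ell1 (fst z) (snd z)"
    have h: "(\<Sum>k\<in>UNIV. r z k * ?h (act_pair k z)) \<le> (exit_rate r z + - \<kappa>) * ?h z" if "z \<in> ?S" for z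
    proof -
      obtain u v where z: "z = (u, v)" by fastforce
      show ?thesis
      proof (cases "u = v")
        case True
        have "r z k * ?h (act_pair k z) = 0" for k
          using diag[of u "fst k" "snd k"] r[of z k] True z
          by (cases "r z k = 0") (auto simp: act_pair_def)
        then have 0: "(\<Sum>k\<in>UNIV. r z k * ?h (act_pair k z)) = 0" by (intro sum.neutral) blast
        show ?thesis unfolding 0 using True z by simp
      next
        case False
        with that z have 1: "ell1 u v = 1" using ell1_ge_1[of u v] by simp
        \<comment> \<open>After a ring of positive rate the distance is at most 1, and it is 0 if
          the chains have met. So the drift of the distance is at most minus the meeting
          rate.\<close>
        have "r z k * ?h (act_pair k z) \<le> r z k - r z k * of_bool (act_opt (fst k) u = act_opt (snd k) v)" for k
          using closed[OF that, of k] r[of z k]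
          by (cases "r z k = 0") (auto simp: act_pair_def z intro!: mult_left_le)
        then have "(\<Sum>k\<in>UNIV. r z k * ?h (act_pair k z)) \<le>
            (\<Sum>k\<in>UNIV. r z k - r z k * of_bool (act_opt (fst k) u = act_opt (snd k) v))"
          by (rule sum_mono)
        also have "\<dots> \<le> exit_rate r z - \<kappa>"
          using coal[of u v] 1 False by (simp add: sum_subtractf exit_rate_def z)
        finally show ?thesis by (simp add: z 1)
      qed
    qed
    have "(\<integral>\<^sup>+ z. ennreal (?h z) \<partial>\<pi>) \<le> ennreal (exp (- \<kappa> * t) * ?h (x, y))"
      by (rule le, rule jump_upto_le_exp[where a = act_pair and r = r and S = ?S and h = ?h,
            OF r closed _ h _ t0]) (use xy in auto)
    then show ?thesis by simp
  qed
  ultimately show ?thesis by (auto simp: couplings_def)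
qed

section \<open>Gluing along shortest paths and mixing over initial laws\<close>

lemma glue_couplings:
  fixes \<pi>1 :: "('a \<times> 'b) pmf" and \<pi>2 :: "('b \<times> 'c) pmf"
  assumes "map_pmf snd \<pi>1 = map_pmf fst \<pi>2"
  obtains \<tau> where "map_pmf (\<lambda>(a, b, c). (a, b)) \<tau> = \<pi>1" "map_pmf (\<lambda>(a, b, c). (b, c)) \<tau> = \<pi>2"
proof
  \<comment> \<open>Given the middle coordinate, the third one is drawn independently of the first,
    from \<open>\<pi>2\<close> conditioned on its first coordinate.\<close>
  define K where "K z = cond_pmf \<pi>2 {w. snd z = fst w}" for z :: "'a \<times> 'b"
  define \<tau> where "\<tau> = bind_pmf \<pi>1 (\<lambda>z. map_pmf (\<lambda>w. (fst z, snd z, snd w)) (K z))"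
  have set: "snd ` set_pmf \<pi>1 = fst ` set_pmf \<pi>2"
    using arg_cong[OF assms, of set_pmf] by simp
  have ne1: "set_pmf \<pi>2 \<inter> {w. snd z = fst w} \<noteq> {}" if "z \<in> set_pmf \<pi>1" for z
    using that set by fastforce
  have ne2: "set_pmf \<pi>1 \<inter> {z. snd z = fst w} \<noteq> {}" if "w \<in> set_pmf \<pi>2" for w
    using that set by fastforce
  \<comment> \<open>The conditioning events have equal weight under both couplings, which share the
    middle marginal. This is what makes the conditional laws average back to
    \<open>\<pi>2\<close>.\<close>
  have eq: "measure \<pi>2 {w. snd z = fst w} = measure \<pi>1 {z'. snd z' = fst w}"
    if "snd z = fst w" for z w
  proof -
    have "measure (map_pmf snd \<pi>1) {snd z} = measure (map_pmf fst \<pi>2) {snd z}"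
      by (simp add: assms)
    then show ?thesis using that by (simp add: vimage_def eq_commute)
  qed
  have fst_K: "fst w = snd z" if "z \<in> set_pmf \<pi>1" "w \<in> set_pmf (K z)" for z w
    using that ne1[OF that(1)] by (simp add: K_def)
  have "map_pmf (\<lambda>(a, b, c). (a, b)) \<tau> = bind_pmf \<pi>1 return_pmf"
    unfolding \<tau>_def map_bind_pmf by (simp add: map_pmf_comp)
  then show "map_pmf (\<lambda>(a, b, c). (a, b)) \<tau> = \<pi>1" by (simp add: bind_return_pmf')
  have "map_pmf (\<lambda>(a, b, c). (b, c)) \<tau> = bind_pmf \<pi>1 (\<lambda>z. map_pmf (\<lambda>w. (snd z, snd w)) (K z))"
    unfolding \<tau>_def map_bind_pmf by (simp add: map_pmf_comp)
  also have "\<dots> = bind_pmf \<pi>1 (\<lambda>z. map_pmf id (K z))"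
    by (intro bind_pmf_cong map_pmf_cong refl) (auto simp: fst_K[symmetric])
  also have "\<dots> = \<pi>2"
    unfolding map_pmf_id id_apply K_def
    by (rule bind_cond_pmf_cancel) (use ne1 ne2 eq in auto)
  finally show "map_pmf (\<lambda>(a, b, c). (b, c)) \<tau> = \<pi>2" .
qed

text \<open>The sure bound and the mean bound both add up under gluing, so both can be carried along
  a path.\<close>

lemma triangle_coupling:
  assumes \<pi>1: "\<pi>1 \<in> couplings \<mu> \<nu>" "\<forall>z\<in>set_pmf \<pi>1. ell1 (fst z) (snd z) \<le> a"
      "(\<integral>\<^sup>+ z. ennreal (ell1 (fst z) (snd z)) \<partial>\<pi>1) \<le> ennreal \<alpha>"
    and \<pi>2: "\<pi>2 \<in> couplings \<nu> \<rho>" "\<forall>z\<in>set_pmf \<pi>2. ell1 (fst z) (snd z) \<le> b"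
      "(\<integral>\<^sup>+ z. ennreal (ell1 (fst z) (snd z)) \<partial>\<pi>2) \<le> ennreal \<beta>"
    and nonneg: "0 \<le> \<alpha>" "0 \<le> \<beta>"
  shows "\<exists>\<pi>\<in>couplings \<mu> \<rho>. (\<forall>z\<in>set_pmf \<pi>. ell1 (fst z) (snd z) \<le> a + b) \<and>
    (\<integral>\<^sup>+ z. ennreal (ell1 (fst z) (snd z)) \<partial>\<pi>) \<le> ennreal (\<alpha> + \<beta>)"
proof -
  have "map_pmf snd \<pi>1 = map_pmf fst \<pi>2" using \<pi>1(1) \<pi>2(1) by (simp add: couplings_def)
  then obtain \<tau> where \<tau>: "map_pmf (\<lambda>(a, b, c). (a, b)) \<tau> = \<pi>1" "map_pmf (\<lambda>(a, b, c). (b, c)) \<tau> = \<pi>2"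
    by (rule glue_couplings)
  let ?\<pi> = "map_pmf (\<lambda>(a, b, c). (a, c)) \<tau>"
  have "map_pmf fst ?\<pi> = map_pmf fst \<pi>1" "map_pmf snd ?\<pi> = map_pmf snd \<pi>2"
    unfolding \<tau>[symmetric] by (simp_all add: map_pmf_comp case_prod_unfold)
  then have "?\<pi> \<in> couplings \<mu> \<rho>" using \<pi>1(1) \<pi>2(1) by (simp add: couplings_def)
  moreover have "ell1 (fst z) (snd z) \<le> a + b" if "z \<in> set_pmf ?\<pi>" for z
  proof -
    from that obtain u v w where uvw: "(u, v, w) \<in> set_pmf \<tau>" "z = (u, w)" by auto
    then have "(u, v) \<in> set_pmf \<pi>1" "(v, w) \<in> set_pmf \<pi>2"
      unfolding \<tau>[symmetric] by force+
    then show ?thesis using \<pi>1(2) \<pi>2(2) ell1_triangle[of u w v] uvw by fastforce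
  qed
  moreover have "(\<integral>\<^sup>+ z. ennreal (ell1 (fst z) (snd z)) \<partial>?\<pi>) \<le> ennreal (\<alpha> + \<beta>)"
  proof -
    have "(\<integral>\<^sup>+ z. ennreal (ell1 (fst z) (snd z)) \<partial>?\<pi>) \<le>
        (\<integral>\<^sup>+ (u, v, w). ennreal (ell1 u v) + ennreal (ell1 v w) \<partial>\<tau>)"
      by (auto intro!: nn_integral_mono ennreal_leI ell1_triangle simp flip: ennreal_plus)
    also have "\<dots> = (\<integral>\<^sup>+ z. ennreal (ell1 (fst z) (snd z)) \<partial>\<pi>1) +
        (\<integral>\<^sup>+ z. ennreal (ell1 (fst z) (snd z)) \<partial>\<pi>2)"
      unfolding \<tau>[symmetric] nn_integral_map_pmf
      by (subst nn_integral_add[symmetric]) (auto simp: case_prod_unfold)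
    also have "\<dots> \<le> ennreal \<alpha> + ennreal \<beta>" by (intro add_mono \<pi>1 \<pi>2)
    finally show ?thesis using nonneg by simp
  qed
  ultimately show ?thesis by blast
qed

lemma path_coupling:
  fixes c :: "'d::finite rates" and \<kappa> C :: real
  assumes c: "\<And>x \<sigma>. 0 \<le> c x \<sigma>" and irr: "property_Irr c m" and t: "0 < t"
    and Dec: "\<And>x i. x $ i = 0 \<Longrightarrow> c x (Dec i) = 0"
    and Inc: "\<And>x i. c x (Inc i) \<le> C"
    and curv: "\<And>x \<sigma>. act \<sigma> x \<noteq> x \<Longrightarrow> 0 \<le> move_curvature c x \<sigma>"
    and \<kappa>: "\<And>x \<sigma>. act \<sigma> x \<noteq> x \<Longrightarrow>
      \<kappa> \<le> move_curvature c x \<sigma> + move_curvature c (act \<sigma> x) (inv_move \<sigma>)"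
  shows "\<exists>\<pi>\<in>couplings (law_at c (return_pmf x) t) (law_at c (return_pmf y) t).
    (\<forall>z\<in>set_pmf \<pi>. ell1 (fst z) (snd z) \<le> ell1 x y) \<and>
    (\<integral>\<^sup>+ z. ennreal (ell1 (fst z) (snd z)) \<partial>\<pi>) \<le> ennreal (exp (- \<kappa> * t) * ell1 x y)"
proof -
  obtain n where "ell1 x y = real n" by (rule ell1_nat)
  then show ?thesis
  proof (induction n arbitrary: x)
    case 0
    then have "x = y" by simp
    then show ?case
      by (intro bexI[of _ "map_pmf (\<lambda>z. (z, z)) (law_at c (return_pmf x) t)"])
         (auto simp: couplings_def map_pmf_comp)
  next
    case (Suc n)
    then have "x \<noteq> y" by auto
    then obtain \<sigma> where \<sigma>: "act \<sigma> x \<noteq> x" "ell1 (act \<sigma> x) y = ell1 x y - 1" by (rule move_towards)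
    have 1: "ell1 x (act \<sigma> x) = 1"
      using ell1_act[of x \<sigma>] ell1_ge_1[of x "act \<sigma> x"] \<sigma>(1) by fastforce
    obtain \<pi>1 where \<pi>1: "\<pi>1\<in>couplings (law_at c (return_pmf x) t) (law_at c (return_pmf (act \<sigma> x)) t)"
      "\<forall>z\<in>set_pmf \<pi>1. ell1 (fst z) (snd z) \<le> 1"
      "(\<integral>\<^sup>+ z. ennreal (ell1 (fst z) (snd z)) \<partial>\<pi>1) \<le> ennreal (exp (- \<kappa> * t))"
      using adjacent_coupling[of c m t C \<kappa> x "act \<sigma> x", OF c irr t Dec Inc curv \<kappa> ell1_act] 1 by auto
    have n: "ell1 (act \<sigma> x) y = real n" using \<sigma> Suc.prems by simp
    obtain \<pi>2 where \<pi>2: "\<pi>2\<in>couplings (law_at c (return_pmf (act \<sigma> x)) t) (law_at c (return_pmf y) t)"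
      "\<forall>z\<in>set_pmf \<pi>2. ell1 (fst z) (snd z) \<le> real n"
      "(\<integral>\<^sup>+ z. ennreal (ell1 (fst z) (snd z)) \<partial>\<pi>2) \<le> ennreal (exp (- \<kappa> * t) * real n)"
      using Suc.IH[OF n] unfolding n by blast
    from triangle_coupling[OF \<pi>1 \<pi>2] show ?case
      by (simp add: Suc.prems algebra_simps)
  qed
qed

lemma path_coupling_powr:
  fixes c :: "'d::finite rates" and \<kappa> C p :: real
  assumes c: "\<And>x \<sigma>. 0 \<le> c x \<sigma>" and irr: "property_Irr c m" and t: "0 < t"
    and Dec: "\<And>x i. x $ i = 0 \<Longrightarrow> c x (Dec i) = 0"
    and Inc: "\<And>x i. c x (Inc i) \<le> C"
    and curv: "\<And>x \<sigma>. act \<sigma> x \<noteq> x \<Longrightarrow> 0 \<le> move_curvature c x \<sigma>"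
    and \<kappa>: "\<And>x \<sigma>. act \<sigma> x \<noteq> x \<Longrightarrow>
      \<kappa> \<le> move_curvature c x \<sigma> + move_curvature c (act \<sigma> x) (inv_move \<sigma>)"
    and p: "1 \<le> p"
  shows "\<exists>\<pi>\<in>couplings (law_at c (return_pmf x) t) (law_at c (return_pmf y) t).
    (\<integral>\<^sup>+ z. ennreal (ell1 (fst z) (snd z) powr p) \<partial>\<pi>) \<le> ennreal (exp (- \<kappa> * t) * ell1 x y powr p)"
proof -
  \<comment> \<open>At a = 0 both sides vanish for every exponent, including the case p = 1, because
    0 \<open>powr\<close> 0 is 0.\<close>
  have split: "a powr p = a powr (p - 1) * a" if "0 \<le> a" for a :: real
    using that powr_add[of a "p - 1" 1] by (cases "a = 0") auto
  obtain \<pi> where \<pi>: "\<pi>\<in>couplings (law_at c (return_pmf x) t) (law_at c (return_pmf y) t)"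
    "\<forall>z\<in>set_pmf \<pi>. ell1 (fst z) (snd z) \<le> ell1 x y"
    "(\<integral>\<^sup>+ z. ennreal (ell1 (fst z) (snd z)) \<partial>\<pi>) \<le> ennreal (exp (- \<kappa> * t) * ell1 x y)"
    using path_coupling[of c m t C \<kappa> x y, OF c irr t Dec Inc curv \<kappa>] by auto
  have "(\<integral>\<^sup>+ z. ennreal (ell1 (fst z) (snd z) powr p) \<partial>\<pi>) \<le>
      (\<integral>\<^sup>+ z. ennreal (ell1 x y powr (p - 1)) * ennreal (ell1 (fst z) (snd z)) \<partial>\<pi>)"
  proof (rule nn_integral_mono_AE, unfold AE_measure_pmf_iff, rule ballI)
    fix z assume "z \<in> set_pmf \<pi>"
    then have "ell1 (fst z) (snd z) powr p \<le> ell1 x y powr (p - 1) * ell1 (fst z) (snd z)"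
      unfolding split[OF ell1_nonneg] using \<pi>(2) p by (intro mult_right_mono powr_mono2) auto
    then show "ennreal (ell1 (fst z) (snd z) powr p) \<le>
        ennreal (ell1 x y powr (p - 1)) * ennreal (ell1 (fst z) (snd z))"
      by (simp flip: ennreal_mult)
  qed
  also have "\<dots> = ennreal (ell1 x y powr (p - 1)) * (\<integral>\<^sup>+ z. ennreal (ell1 (fst z) (snd z)) \<partial>\<pi>)"
    by (rule nn_integral_cmult) simp
  also have "\<dots> \<le> ennreal (ell1 x y powr (p - 1)) * ennreal (exp (- \<kappa> * t) * ell1 x y)"
    by (intro mult_left_mono \<pi>) simp
  also have "\<dots> = ennreal (exp (- \<kappa> * t) * ell1 x y powr p)"
    by (simp add: split[OF ell1_nonneg] mult_ac flip: ennreal_mult)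
  finally show ?thesis using \<pi>(1) by blast
qed

lemma ennreal_powr_mono_scale:
  assumes "u \<le> ennreal a * v" "0 < a" "0 < q"
  shows "ennreal_powr u q \<le> ennreal (a powr q) * ennreal_powr v q"
proof (cases "v = \<infinity>")
  case True
  then show ?thesis using assms by (simp add: ennreal_powr_def ennreal_mult_top)
next
  case False
  then obtain w where w: "v = ennreal w" "0 \<le> w" by (cases v) auto
  have u: "u \<le> ennreal (a * w)" using assms w by (simp add: ennreal_mult)
  then obtain u' where u': "u = ennreal u'" "0 \<le> u'"
    by (cases u) (auto simp: top_unique)
  with u assms w have "u' \<le> a * w" by simp
  then have "u' powr q \<le> a powr q * w powr q"
    using assms w u' by (subst powr_mult[symmetric]) (auto intro!: powr_mono2)
  then show ?thesis using u' w by (simp add: ennreal_powr_def flip: ennreal_mult)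
qed

lemma wasserstein_contraction:
  fixes c :: "'d::finite rates" and \<kappa> C p :: real
  assumes c: "\<And>x \<sigma>. 0 \<le> c x \<sigma>" and irr: "property_Irr c m" and t: "0 < t"
    and Dec: "\<And>x i. x $ i = 0 \<Longrightarrow> c x (Dec i) = 0"
    and Inc: "\<And>x i. c x (Inc i) \<le> C"
    and curv: "\<And>x \<sigma>. act \<sigma> x \<noteq> x \<Longrightarrow> 0 \<le> move_curvature c x \<sigma>"
    and \<kappa>: "\<And>x \<sigma>. act \<sigma> x \<noteq> x \<Longrightarrow>
      \<kappa> \<le> move_curvature c x \<sigma> + move_curvature c (act \<sigma> x) (inv_move \<sigma>)"
    and p: "1 \<le> p"
  shows "wasserstein p (law_at c \<mu> t) (law_at c \<nu> t) \<le>
    ennreal (exp (- (\<kappa> / p) * t)) * wasserstein p \<mu> \<nu>"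
proof -
  let ?cost = "\<lambda>\<pi>. \<integral>\<^sup>+ z. ennreal (ell1 (fst z) (snd z) powr p) \<partial>measure_pmf \<pi>"
  let ?e = "ennreal (exp (- \<kappa> * t))"
  have "\<forall>z. \<exists>\<pi>. \<pi> \<in> couplings (law_at c (return_pmf (fst z)) t) (law_at c (return_pmf (snd z)) t) \<and>
      ?cost \<pi> \<le> ennreal (exp (- \<kappa> * t) * ell1 (fst z) (snd z) powr p)"
    using path_coupling_powr[of c m t C \<kappa> p, OF c irr t Dec Inc curv \<kappa> p] by blast
  from choice[OF this] obtain K where K:
    "\<And>z. K z \<in> couplings (law_at c (return_pmf (fst z)) t) (law_at c (return_pmf (snd z)) t)"
    "\<And>z. ?cost (K z) \<le> ennreal (exp (- \<kappa> * t) * ell1 (fst z) (snd z) powr p)"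
    by blast
  let ?I = "INF \<pi>\<in>couplings (law_at c \<mu> t) (law_at c \<nu> t). ?cost \<pi>"
  have I_le: "?I \<le> ?e * ?cost \<pi>"
    if \<pi>: "\<pi> \<in> couplings \<mu> \<nu>" for \<pi>
  proof -
    let ?\<pi> = "bind_pmf \<pi> K"
    have "map_pmf fst ?\<pi> = bind_pmf (map_pmf fst \<pi>) (\<lambda>x. law_at c (return_pmf x) t)"
      "map_pmf snd ?\<pi> = bind_pmf (map_pmf snd \<pi>) (\<lambda>x. law_at c (return_pmf x) t)"
      using K(1) by (simp_all add: map_bind_pmf bind_map_pmf couplings_def)
    then have "?\<pi> \<in> couplings (law_at c \<mu> t) (law_at c \<nu> t)"
      using \<pi> by (simp add: couplings_def law_at_bind[OF c irr t, symmetric])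
    then have "(INF \<pi>\<in>couplings (law_at c \<mu> t) (law_at c \<nu> t). ?cost \<pi>) \<le> ?cost ?\<pi>"
      by (rule INF_lower)
    also have "?cost ?\<pi> = (\<integral>\<^sup>+ z. ?cost (K z) \<partial>\<pi>)"
      by (simp add: nn_integral_bind_pmf)
    also have "\<dots> \<le> (\<integral>\<^sup>+ z. ?e * ennreal (ell1 (fst z) (snd z) powr p) \<partial>\<pi>)"
      using K(2) by (intro nn_integral_mono) (simp flip: ennreal_mult)
    also have "\<dots> = ?e * ?cost \<pi>" by (rule nn_integral_cmult) simp
    finally show ?thesis .
  qed
  \<comment> \<open>The exponential factor is moved to the other side by its inverse, so that the
    infimum can be taken over the bare costs, and is then moved back.\<close>
  have e: "ennreal (exp (\<kappa> * t)) * ?e = 1" by (simp flip: ennreal_mult exp_add)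
  have "ennreal (exp (\<kappa> * t)) * ?I \<le> ?cost \<pi>" if "\<pi> \<in> couplings \<mu> \<nu>" for \<pi>
    using mult_left_mono[OF I_le[OF that], of "ennreal (exp (\<kappa> * t))"]
    unfolding mult.assoc[symmetric] e by simp
  then have "ennreal (exp (\<kappa> * t)) * ?I \<le> (INF \<pi>\<in>couplings \<mu> \<nu>. ?cost \<pi>)"
    by (rule INF_greatest)
  from mult_left_mono[OF this, of ?e] have "?I \<le> ?e * (INF \<pi>\<in>couplings \<mu> \<nu>. ?cost \<pi>)"
    using e by (simp add: mult.commute flip: mult.assoc)
  then have "ennreal_powr ?I (1 / p) \<le>
      ennreal (exp (- \<kappa> * t) powr (1 / p)) * ennreal_powr (INF \<pi>\<in>couplings \<mu> \<nu>. ?cost \<pi>) (1 / p)"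
    using p by (intro ennreal_powr_mono_scale) auto
  then show ?thesis
    by (simp add: wasserstein_def case_prod_unfold exp_powr_real mult_ac)
qed

section \<open>Curvature from contraction\<close>

definition set_prob :: "'d::finite rates \<Rightarrow> real \<Rightarrow> 'd state \<Rightarrow> 'd state set \<Rightarrow> real" where
  "set_prob c t x W = (\<Sum>w\<in>W. enn2real (transition c t x w))"

lemma set_prob_0:
  assumes "\<And>x \<sigma>. 0 \<le> c x \<sigma>" "finite W"
  shows "set_prob c 0 x W = indicator W x"
  using assms(2) by (simp add: set_prob_def transition_0[OF assms(1)] indicator_def)

text \<open>The law is identified for t > 0 only, whereas \<open>set_prob\<close> also has the right
  value at 0, where the one-sided derivatives are taken. For finite sets these are computed term by
  term.\<close>

lemma measure_law_at_return:
  assumes c: "\<And>x \<sigma>. 0 \<le> c x \<sigma>" and irr: "property_Irr c m" and t: "0 < t" and "finite W"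
  shows "measure (law_at c (return_pmf x) t) W = set_prob c t x W"
proof -
  have "pmf (law_at c (return_pmf x) t) w = enn2real (transition c t x w)" for w
    by (simp flip: law_at_return[OF c irr t])
  then show ?thesis using assms(4) by (simp add: set_prob_def measure_measure_pmf_finite)
qed

text \<open>The endpoint that \<open>backward_equation\<close> leaves out. The
  variation-of-constants formula holds for all t \<ge> 0 and can be differentiated there from the
  right; the value is the generator applied to the indicator of \<open>y\<close>.\<close>

lemma transition_derivative_0:
  fixes c :: "'d::finite rates"
  assumes c: "\<And>x \<sigma>. 0 \<le> c x \<sigma>"
  shows "((\<lambda>t. enn2real (transition c t x y)) has_real_derivative
    (\<Sum>\<sigma>\<in>UNIV. c x \<sigma> * (indicator {y} (act \<sigma> x) - indicator {y} x))) (at 0 within {0..1})"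
proof -
  let ?q = "total_rate c x"
  define f where "f u = (\<Sum>\<sigma>\<in>UNIV. c x \<sigma> * enn2real (transition c u (act \<sigma> x) y))" for u
  let ?G = "\<lambda>s. integral {0..s} (\<lambda>u. exp (?q * u) * f u)"
  have eq: "enn2real (transition c s x y) = exp (- ?q * s) * (indicator {x} y + ?G s)"
    if "0 \<le> s" for s
    unfolding f_def by (rule transition_variation_of_constants(2)) (use c that in auto)
  have "continuous_on {0..1} f"
    unfolding f_def by (intro continuous_intros continuous_on_transition c)
  then have G: "(?G has_real_derivative exp (?q * 0) * f 0) (at 0 within {0..1})"
    by (intro integral_has_real_derivative) (auto intro!: continuous_intros)
  have "((\<lambda>s. exp (- ?q * s)) has_real_derivative exp (- ?q * 0) * - ?q) (at 0 within {0..1})"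
    by (auto intro!: derivative_eq_intros)
  from DERIV_mult[OF this DERIV_add[OF DERIV_const[of "indicator {x} y"] G]]
  have "((\<lambda>s. exp (- ?q * s) * (indicator {x} y + ?G s)) has_real_derivative
      - ?q * indicator {x} y + f 0) (at 0 within {0..1})"
    by simp
  moreover have "- ?q * indicator {x} y + f 0 =
      (\<Sum>\<sigma>\<in>UNIV. c x \<sigma> * (indicator {y} (act \<sigma> x) - indicator {y} x))"
    unfolding f_def total_rate_def transition_0[OF c]
    by (simp add: right_diff_distrib sum_subtractf sum_distrib_right indicator_def eq_commute[of y])
  ultimately have "((\<lambda>s. exp (- ?q * s) * (indicator {x} y + ?G s)) has_real_derivative
      (\<Sum>\<sigma>\<in>UNIV. c x \<sigma> * (indicator {y} (act \<sigma> x) - indicator {y} x))) (at 0 within {0..1})"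
    by simp
  then show ?thesis
    by (rule has_field_derivative_transform_within[where d = 1]) (auto simp: eq)
qed

lemma set_prob_derivative_0:
  fixes c :: "'d::finite rates"
  assumes c: "\<And>x \<sigma>. 0 \<le> c x \<sigma>" and W: "finite W"
  shows "((\<lambda>t. set_prob c t x W) has_real_derivative
    (\<Sum>\<sigma>\<in>UNIV. c x \<sigma> * (indicator W (act \<sigma> x) - indicator W x))) (at_right 0)"
proof -
  have ind: "(\<Sum>w\<in>W. indicator {w} z) = (indicator W z :: real)" for z :: "'d state"
    using W by (simp add: indicator_def)
  have "((\<lambda>t. set_prob c t x W) has_real_derivative
      (\<Sum>w\<in>W. \<Sum>\<sigma>\<in>UNIV. c x \<sigma> * (indicator {w} (act \<sigma> x) - indicator {w} x))) (at 0 within {0..1})"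
    unfolding set_prob_def by (intro DERIV_sum transition_derivative_0 c)
  also have "(\<Sum>w\<in>W. \<Sum>\<sigma>\<in>UNIV. c x \<sigma> * (indicator {w} (act \<sigma> x) - indicator {w} x)) =
      (\<Sum>\<sigma>\<in>UNIV. c x \<sigma> * ((\<Sum>w\<in>W. indicator {w} (act \<sigma> x)) - (\<Sum>w\<in>W. indicator {w} x)))"
    by (subst sum.swap) (simp add: sum_distrib_left[symmetric] sum_subtractf)
  finally show ?thesis by (simp add: ind at_within_Icc_at_right)
qed

text \<open>This turns estimates of probabilities at small times into inequalities between
  rates.\<close>

lemma derivative_le_at_right:
  fixes f g :: "real \<Rightarrow> real"
  assumes f: "(f has_real_derivative f') (at_right a)" and g: "(g has_real_derivative g') (at_right a)"
    and eq: "f a = g a" and le: "\<And>t. a < t \<Longrightarrow> t < b \<Longrightarrow> f t \<le> g t" and "a < b"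
  shows "f' \<le> g'"
proof (rule tendsto_le)
  show "((\<lambda>t. (f t - f a) / (t - a)) \<longlongrightarrow> f') (at_right a)"
    "((\<lambda>t. (g t - g a) / (t - a)) \<longlongrightarrow> g') (at_right a)"
    using f g by (simp_all add: has_field_derivative_iff)
  show "\<forall>\<^sub>F t in at_right a. (f t - f a) / (t - a) \<le> (g t - g a) / (t - a)"
    using eventually_at_right_less eventually_at_right_real[OF \<open>a < b\<close>]
    by eventually_elim (auto simp: eq intro!: divide_right_mono le)
qed simp

section \<open>Separation of states that are two moves apart\<close>

fun move_vec :: "'d move \<Rightarrow> 'd \<Rightarrow> real" where
  "move_vec (Inc i) k = of_bool (i = k)"
| "move_vec (Dec i) k = - of_bool (i = k)"

lemma real_act_nth: "act \<sigma> x \<noteq> x \<Longrightarrow> real (act \<sigma> x $ k) = real (x $ k) + move_vec \<sigma> k"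
  by (cases \<sigma>) (auto simp: axis_def of_nat_diff split: if_splits)

lemma sum_move_vec:
  "(\<Sum>k\<in>UNIV. move_vec \<sigma> k * move_vec \<tau> k) =
    (if \<sigma> = \<tau> then 1 else if \<sigma> = inv_move \<tau> then - 1 else 0)"
  for \<sigma> :: "'d::finite move"
proof -
  have "(\<Sum>k\<in>UNIV. of_bool (i = k) * of_bool (j = k)) = (of_bool (i = j) :: real)" for i j :: 'd
  proof -
    have "(\<Sum>k\<in>UNIV. of_bool (i = k) * of_bool (j = k)) =
        (\<Sum>k\<in>UNIV. if k = i then of_bool (i = j) else 0 :: real)"
      by (intro sum.cong) auto
    then show ?thesis by simp
  qed
  then show ?thesis by (cases \<sigma>; cases \<tau>) (simp_all add: sum_negf)
qed

lemma act_inj: "act \<sigma> x = act \<tau> x \<Longrightarrow> act \<sigma> x \<noteq> x \<Longrightarrow> \<sigma> = \<tau>"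
proof -
  assume eq: "act \<sigma> x = act \<tau> x" and neq: "act \<sigma> x \<noteq> x"
  have "move_vec \<sigma> k = move_vec \<tau> k" for k
    using real_act_nth[OF neq, of k] real_act_nth[of \<tau> x k] eq neq by simp
  then have "(\<Sum>k\<in>UNIV. move_vec \<sigma> k * move_vec \<tau> k) = (\<Sum>k\<in>UNIV. move_vec \<sigma> k * move_vec \<sigma> k)"
    by simp
  then show ?thesis unfolding sum_move_vec by (auto split: if_splits)
qed

text \<open>Duality of the l1 and sup norms: a vector with entries in [-1, 1] certifies a lower
  bound on the distance.\<close>

lemma ell1_ge_test:
  assumes "\<And>k. \<bar>\<theta> k\<bar> \<le> 1"
  shows "(\<Sum>k\<in>UNIV. \<theta> k * (real (v $ k) - real (w $ k))) \<le> ell1 w v"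
  unfolding ell1_def
proof (rule sum_mono)
  fix k
  have "\<theta> k * (real (v $ k) - real (w $ k)) \<le> \<bar>\<theta> k\<bar> * \<bar>real (w $ k) - real (v $ k)\<bar>"
    by (metis abs_ge_self abs_minus_commute abs_mult)
  also have "\<dots> \<le> \<bar>real (w $ k) - real (v $ k)\<bar>"
    using assms[of k] by (intro mult_left_le_one_le) auto
  finally show "\<theta> k * (real (v $ k) - real (w $ k)) \<le> \<bar>real (w $ k) - real (v $ k)\<bar>" .
qed

text \<open>The certificate \<open>\<theta>\<close> is the displacement by both moves, cut down to
  entries of size at most 1. If the moves differ, they act on different coordinates and the pairing
  with the displacement is 1 + 1; if they agree, it is 1 times 2. Any other move pairs with
  \<open>\<theta>\<close> to at most 0, so making it first brings \<open>x\<close> no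
  closer.\<close>

lemma ell1_two_moves:
  assumes \<sigma>: "act \<sigma> x \<noteq> x" and \<tau>: "act \<tau> (act \<sigma> x) \<noteq> act \<sigma> x" and inv: "\<tau> \<noteq> inv_move \<sigma>"
    and \<rho>: "\<rho> \<noteq> \<sigma>" "\<rho> \<noteq> \<tau>"
  shows "2 \<le> ell1 (act \<rho> x) (act \<tau> (act \<sigma> x))" and "2 \<le> ell1 x (act \<tau> (act \<sigma> x))"
proof -
  define \<theta> where "\<theta> k = (if \<tau> = \<sigma> then move_vec \<sigma> k else move_vec \<sigma> k + move_vec \<tau> k)" for k
  have \<theta>: "\<bar>\<theta> k\<bar> \<le> 1" for k
    unfolding \<theta>_def using inv by (cases \<sigma>; cases \<tau>) auto
  have inv': "\<sigma> \<noteq> inv_move \<tau>" using inv by auto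
  have *: "(\<Sum>k\<in>UNIV. \<theta> k * (move_vec \<sigma> k + move_vec \<tau> k)) = 2"
    using inv inv' unfolding \<theta>_def
    by (cases "\<tau> = \<sigma>")
       (simp_all only: distrib_left distrib_right sum.distrib sum_move_vec if_True if_False,
        simp_all add: sum_move_vec)
  have d: "real (act \<tau> (act \<sigma> x) $ k) = real (x $ k) + (move_vec \<sigma> k + move_vec \<tau> k)" for k
    using real_act_nth[OF \<tau>, of k] real_act_nth[OF \<sigma>, of k] by simp
  have "2 = (\<Sum>k\<in>UNIV. \<theta> k * (real (act \<tau> (act \<sigma> x) $ k) - real (x $ k)))"
    unfolding d by (simp add: *)
  also have "\<dots> \<le> ell1 x (act \<tau> (act \<sigma> x))" by (rule ell1_ge_test[OF \<theta>])
  finally show 2: "2 \<le> ell1 x (act \<tau> (act \<sigma> x))" .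
  show "2 \<le> ell1 (act \<rho> x) (act \<tau> (act \<sigma> x))"
  proof (cases "act \<rho> x = x")
    case False
    have **: "(\<Sum>k\<in>UNIV. \<theta> k * move_vec \<rho> k) \<le> 0"
      unfolding \<theta>_def using \<rho>
      by (cases "\<tau> = \<sigma>") (simp_all add: distrib_right sum.distrib sum_move_vec)
    have "(\<Sum>k\<in>UNIV. \<theta> k * (real (act \<tau> (act \<sigma> x) $ k) - real (act \<rho> x $ k))) =
        (\<Sum>k\<in>UNIV. \<theta> k * (move_vec \<sigma> k + move_vec \<tau> k)) - (\<Sum>k\<in>UNIV. \<theta> k * move_vec \<rho> k)"
      unfolding d real_act_nth[OF False] by (simp add: sum_subtractf[symmetric] algebra_simps)
    then have "2 \<le> (\<Sum>k\<in>UNIV. \<theta> k * (real (act \<tau> (act \<sigma> x) $ k) - real (act \<rho> x $ k)))"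
      using * ** by simp
    also have "\<dots> \<le> ell1 (act \<rho> x) (act \<tau> (act \<sigma> x))" by (rule ell1_ge_test[OF \<theta>])
    finally show ?thesis .
  qed (simp add: 2)
qed

text \<open>The lattice is bipartite, which rules out common neighbours of two adjacent
  states.\<close>

lemma even_state_total_act: "act \<sigma> x \<noteq> x \<Longrightarrow> even (state_total (act \<sigma> x)) \<longleftrightarrow> odd (state_total x)"
proof (cases \<sigma>)
  case (Inc i)
  then show ?thesis using state_total_act_Inc[of i x] by (simp del: act.simps)
next
  case (Dec i)
  assume "act \<sigma> x \<noteq> x"
  then have "0 < x $ i" using Dec by (auto split: if_splits)
  from state_total_act_Dec[OF this] show ?thesis using Dec by (simp del: act.simps)
qed

section \<open>Meetings of coupled chains at small times\<close>

lemma measure_coupling: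
  assumes "\<pi> \<in> couplings \<mu> \<nu>"
  shows "measure \<pi> {z. fst z \<in> A} = measure \<mu> A" "measure \<pi> {z. snd z \<in> A} = measure \<nu> A"
  using assms by (auto simp: couplings_def vimage_def)

text \<open>
  If the second chain is at a point of \<open>T\<close> while the two chains are adjacent, then the first
  chain has left \<open>W\<close>.  As the two chains can also only meet at \<open>y\<close> if the first one has left
  \<open>W\<close>, this bounds the probability of a meeting at \<open>y\<close>.
\<close>

lemma meeting_probability_le:
  fixes c :: "'d::finite rates" and x :: "'d state"
  assumes c: "\<And>x \<sigma>. 0 \<le> c x \<sigma>" and irr: "property_Irr c m"
    and eff: "\<And>x \<sigma>. act \<sigma> x = x \<Longrightarrow> c x \<sigma> = 0"
    and \<sigma>: "act \<sigma> x \<noteq> x"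
  defines "y \<equiv> act \<sigma> x"
  obtains \<Phi> where "\<Phi> 0 = 0" "(\<Phi> has_real_derivative move_curvature c x \<sigma>) (at_right 0)"
    "\<And>t \<pi>. 0 < t \<Longrightarrow> \<pi> \<in> couplings (law_at c (return_pmf x) t) (law_at c (return_pmf y) t) \<Longrightarrow>
      measure \<pi> {(y, y)} \<le> \<Phi> t + measure \<pi> {z. 2 \<le> ell1 (fst z) (snd z)}"
proof
  \<comment> \<open>\<open>A\<close> collects the moves with an excess at \<open>y\<close>, so the
    excesses over \<open>A\<close> add up to the positive parts in the curvature. The sets
    \<open>W\<close> and \<open>T\<close> are made so that, to first order, leaving \<open>W\<close>
    from \<open>x\<close> has the rates of \<open>B\<close> at \<open>x\<close> and entering
    \<open>T\<close> from \<open>y\<close> those of \<open>B\<close> at \<open>y\<close>; the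
    difference of these totals is the curvature.\<close>
  define A where "A = {\<gamma>. \<gamma> \<noteq> \<sigma> \<and> \<gamma> \<noteq> inv_move \<sigma> \<and> c x \<gamma> < c y \<gamma>}"
  define B where "B = insert \<sigma> A"
  define W where "W = insert x ((\<lambda>\<rho>. act \<rho> x) ` (- B))"
  define T where "T = (\<lambda>\<tau>. act \<tau> y) ` B - {y}"
  have fin: "finite W" "finite T" "finite B" "finite A" by (auto simp: W_def T_def)
  let ?\<Phi> = "\<lambda>t. 1 - set_prob c t x W - set_prob c t y T"
  have W_iff: "act \<gamma> x \<in> W \<longleftrightarrow> \<gamma> \<notin> B \<or> act \<gamma> x = x" for \<gamma>
  proof (cases "act \<gamma> x = x")
    case False
    then have "act \<gamma> x \<in> W \<longleftrightarrow> (\<exists>\<rho>. \<rho> \<notin> B \<and> act \<gamma> x = act \<rho> x)" by (auto simp: W_def)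
    also have "\<dots> \<longleftrightarrow> \<gamma> \<notin> B" using act_inj[OF _ False] by blast
    finally show ?thesis using False by simp
  qed (simp add: W_def)
  have T_iff: "act \<gamma> y \<in> T \<longleftrightarrow> \<gamma> \<in> B \<and> act \<gamma> y \<noteq> y" for \<gamma>
    using act_inj[of \<gamma> y] by (auto simp: T_def)
  have [simp]: "x \<in> W" "y \<notin> T" by (auto simp: W_def T_def)
  have "y \<notin> W" using W_iff[of \<sigma>] \<sigma> by (simp add: y_def B_def)
  have "inv_move \<sigma> \<notin> B" by (simp add: B_def A_def)
  have dist: "2 \<le> ell1 w v" if wv: "w \<in> W" "v \<in> T" for w v
  proof -
    obtain \<tau> where \<tau>: "\<tau> \<in> B" "v = act \<tau> y" "act \<tau> y \<noteq> y" using wv by (auto simp: T_def)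
    then have "\<tau> \<noteq> inv_move \<sigma>" using \<open>inv_move \<sigma> \<notin> B\<close> by auto
    note * = ell1_two_moves[OF \<sigma> \<tau>(3)[unfolded y_def] this]
    show ?thesis
    proof (cases "w = x")
      case True
      \<comment> \<open>Here \<open>inv_move \<sigma>\<close> only fills the place of the third
        move: it differs from \<sigma> and from \<tau>.\<close>
      then show ?thesis using *(2)[of "inv_move \<sigma>"] \<open>\<tau> \<noteq> inv_move \<sigma>\<close> \<tau> by (simp add: y_def)
    next
      case False
      then obtain \<rho> where "\<rho> \<notin> B" "w = act \<rho> x" using wv by (auto simp: W_def)
      then show ?thesis using *(1)[of \<rho>] \<tau> by (auto simp: y_def B_def)
    qed
  qed
  show "?\<Phi> 0 = 0" by (simp add: set_prob_0[OF c] fin)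
  have "(\<Sum>\<gamma>\<in>UNIV. c x \<gamma> * (indicator W (act \<gamma> x) - indicator W x)) = (\<Sum>\<gamma>\<in>UNIV. if \<gamma> \<in> B then - c x \<gamma> else 0)"
    using eff by (intro sum.cong refl) (auto simp: W_iff indicator_def)
  also have "\<dots> = - (\<Sum>\<gamma>\<in>B. c x \<gamma>)"
    by (simp add: sum.If_cases sum_negf)
  finally have x: "(\<Sum>\<gamma>\<in>UNIV. c x \<gamma> * (indicator W (act \<gamma> x) - indicator W x)) = - (\<Sum>\<gamma>\<in>B. c x \<gamma>)" .
  have "(\<Sum>\<gamma>\<in>UNIV. c y \<gamma> * (indicator T (act \<gamma> y) - indicator T y)) = (\<Sum>\<gamma>\<in>UNIV. if \<gamma> \<in> B then c y \<gamma> else 0)"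
    using eff by (intro sum.cong refl) (auto simp: T_iff indicator_def)
  also have "\<dots> = (\<Sum>\<gamma>\<in>B. c y \<gamma>)"
    by (simp add: sum.If_cases)
  finally have y: "(\<Sum>\<gamma>\<in>UNIV. c y \<gamma> * (indicator T (act \<gamma> y) - indicator T y)) = (\<Sum>\<gamma>\<in>B. c y \<gamma>)" .
  have "(\<Sum>\<gamma>\<in>UNIV - {\<sigma>, inv_move \<sigma>}. max (c y \<gamma> - c x \<gamma>) 0) = (\<Sum>\<gamma>\<in>A. max (c y \<gamma> - c x \<gamma>) 0)"
    by (rule sum.mono_neutral_right) (auto simp: A_def)
  also have "\<dots> = (\<Sum>\<gamma>\<in>A. c y \<gamma>) - (\<Sum>\<gamma>\<in>A. c x \<gamma>)"
    unfolding sum_subtractf[symmetric] by (intro sum.cong) (auto simp: A_def)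
  finally have curv: "move_curvature c x \<sigma> = 0 - - (\<Sum>\<gamma>\<in>B. c x \<gamma>) - (\<Sum>\<gamma>\<in>B. c y \<gamma>)"
    by (simp add: move_curvature_def B_def A_def fin flip: y_def)
  show "(?\<Phi> has_real_derivative move_curvature c x \<sigma>) (at_right 0)"
    unfolding curv x[symmetric] y[symmetric]
    by (intro DERIV_diff DERIV_const set_prob_derivative_0 c fin)
  fix t \<pi>
  assume t: "0 < t" and \<pi>: "\<pi> \<in> couplings (law_at c (return_pmf x) t) (law_at c (return_pmf y) t)"
  have "measure \<pi> {(y, y)} + measure \<pi> {z. snd z \<in> T} = measure \<pi> ({(y, y)} \<union> {z. snd z \<in> T})"
    by (subst measure_pmf.finite_measure_Union) auto
  also have "\<dots> \<le> measure \<pi> ({z. fst z \<in> - W} \<union> {z. 2 \<le> ell1 (fst z) (snd z)})"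
    using dist \<open>y \<notin> W\<close> by (intro measure_pmf.finite_measure_mono) auto
  also have "\<dots> \<le> measure \<pi> {z. fst z \<in> - W} + measure \<pi> {z. 2 \<le> ell1 (fst z) (snd z)}"
    by (rule measure_Un_le) auto
  also have "measure \<pi> {z. fst z \<in> - W} = 1 - set_prob c t x W"
    unfolding measure_coupling[OF \<pi>]
    using measure_pmf.prob_compl[of W "law_at c (return_pmf x) t"]
    by (simp add: Compl_eq_Diff_UNIV measure_law_at_return[OF c irr t fin(1)])
  also have "measure \<pi> {z. snd z \<in> T} = set_prob c t y T"
    unfolding measure_coupling[OF \<pi>] by (rule measure_law_at_return[OF c irr t fin(2)])
  finally show "measure \<pi> {(y, y)} \<le> ?\<Phi> t + measure \<pi> {z. 2 \<le> ell1 (fst z) (snd z)}"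
    by simp
qed

text \<open>Leaving takes at least two jumps and so has probability o(t): every single move from
  \<open>x\<close> stays in the set, and the first-order term vanishes.\<close>

lemma leave_neighbourhood:
  fixes c :: "'d::finite rates" and x :: "'d state"
  assumes c: "\<And>x \<sigma>. 0 \<le> c x \<sigma>" and irr: "property_Irr c m"
  obtains \<Psi> where "\<Psi> 0 = 0" "(\<Psi> has_real_derivative 0) (at_right 0)"
    "\<And>t. 0 < t \<Longrightarrow> measure (law_at c (return_pmf x) t) (- insert x (range (\<lambda>\<gamma>. act \<gamma> x))) = \<Psi> t"
proof
  let ?S = "insert x (range (\<lambda>\<gamma>. act \<gamma> x))"
  let ?\<Psi> = "\<lambda>t. 1 - set_prob c t x ?S"
  have fin: "finite ?S" by simp
  show "?\<Psi> 0 = 0" by (simp add: set_prob_0[OF c])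
  have "(?\<Psi> has_real_derivative 0 - (\<Sum>\<sigma>\<in>UNIV. c x \<sigma> * (indicator ?S (act \<sigma> x) - indicator ?S x))) (at_right 0)"
    by (intro DERIV_diff DERIV_const set_prob_derivative_0 c fin)
  then show "(?\<Psi> has_real_derivative 0) (at_right 0)" by simp
  show "measure (law_at c (return_pmf x) t) (- ?S) = ?\<Psi> t" if "0 < t" for t
    using measure_pmf.prob_compl[of ?S "law_at c (return_pmf x) t"]
    by (simp add: Compl_eq_Diff_UNIV measure_law_at_return[OF c irr that fin])
qed

section \<open>Couplings supplied by the contraction\<close>

lemma couplings_swap: "\<pi> \<in> couplings \<mu> \<nu> \<Longrightarrow> map_pmf prod.swap \<pi> \<in> couplings \<nu> \<mu>"
  by (simp add: couplings_def map_pmf_comp)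

text \<open>Raising the contraction estimate to the power p turns its factor into e^(-\<kappa> t), a
  bound on the cost that is free of p. The slack \<epsilon> stands in for attainment of the
  infimum.\<close>

lemma near_optimal_coupling:
  fixes \<kappa> p t \<epsilon> :: real and \<mu> \<nu> :: "'d::finite state pmf" and x y :: "'d state"
  assumes le: "wasserstein p \<mu> \<nu> \<le>
      ennreal (exp (- (\<kappa> / p) * t)) * wasserstein p (return_pmf x) (return_pmf y)"
    and xy: "ell1 x y = 1" and p: "1 \<le> p" and \<epsilon>: "0 < \<epsilon>"
  obtains \<pi> where "\<pi> \<in> couplings \<mu> \<nu>"
    "(\<integral>\<^sup>+ z. ennreal (ell1 (fst z) (snd z) powr p) \<partial>\<pi>) < ennreal (exp (- \<kappa> * t) + \<epsilon>)"
proof -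
  let ?I = "\<lambda>\<mu> \<nu>. INF \<pi>\<in>couplings \<mu> \<nu>. \<integral>\<^sup>+ z. ennreal (ell1 (fst z) (snd z) powr p) \<partial>measure_pmf \<pi>"
  have w: "wasserstein p \<mu> \<nu> = ennreal_powr (?I \<mu> \<nu>) (1 / p)" for \<mu> \<nu> :: "'d state pmf"
    by (simp add: wasserstein_def case_prod_unfold)
  have "?I (return_pmf x) (return_pmf y) \<le>
      (\<integral>\<^sup>+ z. ennreal (ell1 (fst z) (snd z) powr p) \<partial>measure_pmf (return_pmf (x, y)))"
    by (rule INF_lower) (simp add: couplings_def)
  then have "?I (return_pmf x) (return_pmf y) \<le> ennreal 1 * 1" using xy by simp
  from ennreal_powr_mono_scale[OF this, of "1 / p"]
  moreover have "ennreal_powr 1 (1 / p) = 1" by (simp add: ennreal_powr_def)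
  ultimately have 1: "wasserstein p (return_pmf x) (return_pmf y) \<le> 1"
    using p unfolding w by simp
  have "wasserstein p \<mu> \<nu> \<le> ennreal (exp (- (\<kappa> / p) * t)) * 1"
    by (rule order_trans[OF le mult_left_mono[OF 1]]) simp
  then have *: "ennreal_powr (?I \<mu> \<nu>) (1 / p) \<le> ennreal (exp (- (\<kappa> / p) * t))"
    unfolding w by simp
  have "?I \<mu> \<nu> \<noteq> \<infinity>"
  proof
    assume I: "?I \<mu> \<nu> = \<infinity>"
    show False using * unfolding I ennreal_powr_def by (simp add: top_unique)
  qed
  then obtain i where i: "?I \<mu> \<nu> = ennreal i" "0 \<le> i" by (cases "?I \<mu> \<nu>") auto
  with * have "i powr (1 / p) \<le> exp (- (\<kappa> / p) * t)" by (simp add: ennreal_powr_def)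
  then have "(i powr (1 / p)) powr p \<le> exp (- (\<kappa> / p) * t) powr p"
    using p by (intro powr_mono2) auto
  also have "exp (- (\<kappa> / p) * t) powr p = exp (- \<kappa> * t)" using p by (simp add: powr_def)
  also have "(i powr (1 / p)) powr p = i" using p i by (simp add: powr_powr)
  finally have "?I \<mu> \<nu> < ennreal (exp (- \<kappa> * t) + \<epsilon>)"
    unfolding i(1) using \<epsilon> i(2) by (intro ennreal_lessI) (auto simp: add_pos_pos)
  then show ?thesis unfolding INF_less_iff using that by blast
qed

lemma markov_pmf:
  assumes "(\<integral>\<^sup>+ z. ennreal (f z) \<partial>measure_pmf \<pi>) \<le> ennreal b" "0 \<le> b" "0 < a"
    and "\<And>z. z \<in> A \<Longrightarrow> a \<le> f z"
  shows "measure \<pi> A \<le> b / a"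
proof -
  have "ennreal (a * measure \<pi> A) = (\<integral>\<^sup>+ z. ennreal a * indicator A z \<partial>measure_pmf \<pi>)"
    using assms(3) by (simp add: nn_integral_cmult measure_pmf.emeasure_eq_measure ennreal_mult)
  also have "\<dots> \<le> (\<integral>\<^sup>+ z. ennreal (f z) \<partial>measure_pmf \<pi>)"
    by (intro nn_integral_mono) (auto simp: assms(4) ennreal_leI split: split_indicator)
  also note assms(1)
  finally show ?thesis using assms(2,3) by (simp add: field_simps)
qed

text \<open>The exponent is chosen depending on t, so the estimates for all p are used at one time.
  Errors of size t^2 do not affect derivatives at 0.\<close>

lemma contraction_coupling:
  fixes \<kappa> t :: real and \<mu> \<nu> :: "'d::finite state pmf" and x y :: "'d state"
  assumes le: "\<And>p. 1 \<le> p \<Longrightarrow> wasserstein p \<mu> \<nu> \<le>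
      ennreal (exp (- (\<kappa> / p) * t)) * wasserstein p (return_pmf x) (return_pmf y)"
    and xy: "ell1 x y = 1" and t: "0 < t" "t < 1" and \<kappa>: "0 \<le> \<kappa>"
  obtains \<pi> where "\<pi> \<in> couplings \<mu> \<nu>" "measure \<pi> {z. 2 \<le> ell1 (fst z) (snd z)} \<le> t\<^sup>2"
    "measure \<pi> {z. fst z \<noteq> snd z} \<le> exp (- \<kappa> * t) + t\<^sup>2"
proof -
  \<comment> \<open>This \<open>n\<close> makes 2 / 2^p at most t^2. The numerator 2 bounds the cost
    e^(-\<kappa> t) + t^2 for t < 1, and 2^p is the least cost of a pair at distance at least
    2.\<close>
  obtain n where n: "2 / t\<^sup>2 < 2 ^ n" using real_arch_pow[of 2 "2 / t\<^sup>2"] by auto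
  define p where "p = real (Suc n)"
  have p: "1 \<le> p" by (simp add: p_def)
  have "2 / t\<^sup>2 \<le> 2 powr p"
    unfolding p_def powr_realpow[OF zero_less_numeral]
    using order_less_imp_le[OF less_le_trans[OF n, of "2 * 2 ^ n"]] by simp
  then have pt: "2 / 2 powr p \<le> t\<^sup>2" using t by (simp add: field_simps)
  obtain \<pi> where \<pi>: "\<pi> \<in> couplings \<mu> \<nu>"
    "(\<integral>\<^sup>+ z. ennreal (ell1 (fst z) (snd z) powr p) \<partial>\<pi>) < ennreal (exp (- \<kappa> * t) + t\<^sup>2)"
    using near_optimal_coupling[OF le[OF p] xy p, of "t\<^sup>2"] t by auto
  have b: "0 \<le> exp (- \<kappa> * t) + t\<^sup>2" by simp
  have "exp (- \<kappa> * t) \<le> 1" "t\<^sup>2 \<le> 1" using \<kappa> t by (simp_all add: power_le_one)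
  then have 2: "exp (- \<kappa> * t) + t\<^sup>2 \<le> 2" by linarith
  show ?thesis
  proof
    show "\<pi> \<in> couplings \<mu> \<nu>" by fact
    have "measure \<pi> {z. 2 \<le> ell1 (fst z) (snd z)} \<le> (exp (- \<kappa> * t) + t\<^sup>2) / 2 powr p"
      by (rule markov_pmf[OF less_imp_le[OF \<pi>(2)] b]) (use p in \<open>auto intro: powr_mono2\<close>)
    also have "\<dots> \<le> 2 / 2 powr p" using 2 by (intro divide_right_mono) auto
    also note pt
    finally show "measure \<pi> {z. 2 \<le> ell1 (fst z) (snd z)} \<le> t\<^sup>2" .
    have "measure \<pi> {z. fst z \<noteq> snd z} \<le> (exp (- \<kappa> * t) + t\<^sup>2) / 1"
    proof (rule markov_pmf[OF less_imp_le[OF \<pi>(2)] b])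
      fix z :: "'d state \<times> 'd state" assume "z \<in> {z. fst z \<noteq> snd z}"
      then have "1 powr p \<le> ell1 (fst z) (snd z) powr p"
        using p by (intro powr_mono2 ell1_ge_1) auto
      then show "1 \<le> ell1 (fst z) (snd z) powr p" by simp
    qed simp
    then show "measure \<pi> {z. fst z \<noteq> snd z} \<le> exp (- \<kappa> * t) + t\<^sup>2" by simp
  qed
qed

text \<open>The chains agree at time t with probability at least 1 - e^(-\<kappa> t) - t^2, that is
  \<kappa> t to first order. Up to o(t) they can agree only at the two endpoints, and each of these
  meetings is bounded by a curvature. Nonnegativity of a single meeting probability gives the sign
  of a curvature.\<close>

lemma curvature_of_contraction:
  fixes c :: "'d::finite rates" and \<kappa> :: real
  assumes c: "\<And>x \<sigma>. 0 \<le> c x \<sigma>" and irr: "property_Irr c m"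
    and eff: "\<And>x \<sigma>. act \<sigma> x = x \<Longrightarrow> c x \<sigma> = 0" and \<kappa>: "0 \<le> \<kappa>"
    and contr: "\<And>p t x y. 1 \<le> p \<Longrightarrow> 0 < t \<Longrightarrow>
      wasserstein p (law_at c (return_pmf x) t) (law_at c (return_pmf y) t) \<le>
        ennreal (exp (- (\<kappa> / p) * t)) * wasserstein p (return_pmf x) (return_pmf y)"
    and \<sigma>: "act \<sigma> x \<noteq> x"
  shows "0 \<le> move_curvature c x \<sigma>"
    and "\<kappa> \<le> move_curvature c x \<sigma> + move_curvature c (act \<sigma> x) (inv_move \<sigma>)"
proof -
  let ?y = "act \<sigma> x"
  have inv: "act (inv_move \<sigma>) ?y = x" by (rule act_inv_move[OF \<sigma>])
  have \<sigma>': "act (inv_move \<sigma>) ?y \<noteq> ?y" using \<sigma> inv by simp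
  have 1: "ell1 x ?y = 1" using ell1_act[of x \<sigma>] ell1_ge_1[of x ?y] \<sigma> by fastforce
  let ?P = "\<lambda>x t. law_at c (return_pmf x) t"
  obtain \<Phi> where \<Phi>: "\<Phi> 0 = 0" "(\<Phi> has_real_derivative move_curvature c x \<sigma>) (at_right 0)"
    "\<And>t \<pi>. 0 < t \<Longrightarrow> \<pi> \<in> couplings (?P x t) (?P ?y t) \<Longrightarrow>
      measure \<pi> {(?y, ?y)} \<le> \<Phi> t + measure \<pi> {z. 2 \<le> ell1 (fst z) (snd z)}"
    by (rule meeting_probability_le[of c m \<sigma> x]) (rule c irr \<sigma> | erule eff | (rule that; assumption))+
  obtain \<Phi>' where \<Phi>': "\<Phi>' 0 = 0"
    "(\<Phi>' has_real_derivative move_curvature c ?y (inv_move \<sigma>)) (at_right 0)"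
    "\<And>t \<pi>. 0 < t \<Longrightarrow> \<pi> \<in> couplings (?P ?y t) (?P x t) \<Longrightarrow>
      measure \<pi> {(x, x)} \<le> \<Phi>' t + measure \<pi> {z. 2 \<le> ell1 (fst z) (snd z)}"
    by (rule meeting_probability_le[of c m "inv_move \<sigma>" ?y, unfolded inv])
       (rule c irr \<sigma>[symmetric] | erule eff | (rule that; assumption))+
  define S where "S x = insert x (range (\<lambda>\<gamma>. act \<gamma> x))" for x :: "'d state"
  obtain \<Psi> where \<Psi>: "\<Psi> 0 = 0" "(\<Psi> has_real_derivative 0) (at_right 0)"
    "\<And>t. 0 < t \<Longrightarrow> measure (?P x t) (- S x) = \<Psi> t"
    by (rule leave_neighbourhood[of c m x, folded S_def]) (rule c irr | (rule that; assumption))+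
  obtain \<Psi>' where \<Psi>': "\<Psi>' 0 = 0" "(\<Psi>' has_real_derivative 0) (at_right 0)"
    "\<And>t. 0 < t \<Longrightarrow> measure (?P ?y t) (- S ?y) = \<Psi>' t"
    by (rule leave_neighbourhood[of c m ?y, folded S_def]) (rule c irr | (rule that; assumption))+
  \<comment> \<open>A state other than \<open>x\<close> and \<open>?y\<close> that is one move away
    from both would have a total of both parities.\<close>
  have common: "a = x \<or> a = ?y" if "a \<in> S x" "a \<in> S ?y" for a
  proof (rule ccontr)
    assume *: "\<not> (a = x \<or> a = ?y)"
    from * obtain \<rho> where "a = act \<rho> x" using \<open>a \<in> S x\<close> by (auto simp: S_def)
    moreover from * obtain \<tau> where "a = act \<tau> ?y" using \<open>a \<in> S ?y\<close> by (auto simp: S_def)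
    moreover note * even_state_total_act[OF \<sigma>] even_state_total_act[of \<rho> x] even_state_total_act[of \<tau> ?y]
    ultimately show False by metis
  qed
  have est: "0 \<le> \<Phi> t + t\<^sup>2"
    "1 - exp (- \<kappa> * t) \<le> \<Phi> t + \<Phi>' t + \<Psi> t + \<Psi>' t + 3 * t\<^sup>2" if t: "0 < t" "t < 1" for t
  proof -
    obtain \<pi> where \<pi>: "\<pi> \<in> couplings (?P x t) (?P ?y t)"
      "measure \<pi> {z. 2 \<le> ell1 (fst z) (snd z)} \<le> t\<^sup>2"
      "measure \<pi> {z. fst z \<noteq> snd z} \<le> exp (- \<kappa> * t) + t\<^sup>2"
      by (rule contraction_coupling[OF contr 1 t \<kappa>]) (use t in auto)
    have y: "measure \<pi> {(?y, ?y)} \<le> \<Phi> t + t\<^sup>2"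
      using \<Phi>(3)[OF t(1) \<pi>(1)] \<pi>(2) by simp
    then show "0 \<le> \<Phi> t + t\<^sup>2" using measure_nonneg[of \<pi> "{(?y, ?y)}"] by linarith
    have swap: "prod.swap -` {(x, x)} = {(x, x)}"
      "prod.swap -` {z. 2 \<le> ell1 (fst z) (snd z)} = {z. 2 \<le> ell1 (fst z) (snd z)}"
      by (auto simp: ell1_commute)
    from \<Phi>'(3)[OF t(1) couplings_swap[OF \<pi>(1)]] have x: "measure \<pi> {(x, x)} \<le> \<Phi>' t + t\<^sup>2"
      unfolding measure_map_pmf swap using \<pi>(2) by linarith
    have "1 - measure \<pi> {z. fst z \<noteq> snd z} = measure \<pi> (UNIV - {z. fst z \<noteq> snd z})"
      using measure_pmf.prob_compl[of "{z. fst z \<noteq> snd z}" \<pi>] by simp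
    \<comment> \<open>If the chains agree at neither endpoint, at least one of them has left its
      closed neighbourhood.\<close>
    also have "\<dots> \<le> measure \<pi> ({(?y, ?y)} \<union> {(x, x)} \<union> {z. fst z \<in> - S x} \<union> {z. snd z \<in> - S ?y})"
      by (intro measure_pmf.finite_measure_mono) (auto dest: common)
    also have "\<dots> \<le> measure \<pi> {(?y, ?y)} + measure \<pi> {(x, x)} +
        measure \<pi> {z. fst z \<in> - S x} + measure \<pi> {z. snd z \<in> - S ?y}"
      by (intro order_trans[OF measure_Un_le] add_mono order_refl) auto
    also have "\<dots> = measure \<pi> {(?y, ?y)} + measure \<pi> {(x, x)} + \<Psi> t + \<Psi>' t"
      unfolding measure_coupling[OF \<pi>(1)] \<Psi>(3)[OF t(1)] \<Psi>'(3)[OF t(1)] ..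
    \<comment> \<open>One t^2 comes from each of the two meeting bounds and one from the bound on
      the probability of being apart.\<close>
    finally show "1 - exp (- \<kappa> * t) \<le> \<Phi> t + \<Phi>' t + \<Psi> t + \<Psi>' t + 3 * t\<^sup>2"
      using \<pi>(3) x y by linarith
  qed
  have sq: "((\<lambda>t. a * t\<^sup>2) has_real_derivative 0) (at_right 0)" for a :: real
    by (auto intro!: derivative_eq_intros)
  have "((\<lambda>t. \<Phi> t + 1 * t\<^sup>2) has_real_derivative move_curvature c x \<sigma> + 0) (at_right 0)"
    by (intro DERIV_add \<Phi> sq)
  from derivative_le_at_right[OF DERIV_const[of 0] this, of 1]
  show "0 \<le> move_curvature c x \<sigma>" using est(1) \<Phi>(1) by simp
  have "((\<lambda>t. 1 - exp (- \<kappa> * t)) has_real_derivative \<kappa>) (at_right 0)"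
    by (auto intro!: derivative_eq_intros)
  moreover have "((\<lambda>t. \<Phi> t + \<Phi>' t + \<Psi> t + \<Psi>' t + 3 * t\<^sup>2) has_real_derivative
      move_curvature c x \<sigma> + move_curvature c ?y (inv_move \<sigma>) + 0 + 0 + 0) (at_right 0)"
    by (intro DERIV_add \<Phi> \<Phi>' \<Psi> \<Psi>' sq)
  ultimately have "\<kappa> \<le> move_curvature c x \<sigma> + move_curvature c ?y (inv_move \<sigma>) + 0 + 0 + 0"
    by (rule derivative_le_at_right[where b = 1]) (use est(2) \<Phi>(1) \<Phi>'(1) \<Psi>(1) \<Psi>'(1) in auto)
  then show "\<kappa> \<le> move_curvature c x \<sigma> + move_curvature c ?y (inv_move \<sigma>)" by simp
qed

theorem theorem3p2:
  fixes Vm Vp :: "'d::finite state \<Rightarrow> real"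
    and m :: "'d state pmf"
    and c :: "'d rates"
    and \<kappa> :: real
  assumes c_def: "c = potential_rates Vm Vp"
    and Irr: "property_Irr c m"
    and Rev: "property_Rev c m"
    and Vp_bound: "bdd_below (range (\<lambda>(\<eta>, i). grad (Inc i) Vp \<eta>))"
    and Vm_bound: "\<And>(K::real) i. K > 0 \<Longrightarrow> bdd_below (grad (Dec i) Vm ` {\<eta>. real (\<eta> $ i) \<le> K})"
    and kappa_pos: "\<kappa> > 0"
  shows "(\<forall>p::real. p \<ge> 1 \<longrightarrow>
            (\<forall>\<mu>\<in>finite_moment_laws p. \<forall>\<nu>\<in>finite_moment_laws p. \<forall>t>0.
               wasserstein p (law_at c \<mu> t) (law_at c \<nu> t)
                 \<le> ennreal (exp (- (\<kappa> / p) * t)) * wasserstein p \<mu> \<nu>))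
     \<longleftrightarrow>
         (\<forall>\<eta> i. kappa_plus c \<eta> i \<ge> 0 \<and> kappa_minus c \<eta> i \<ge> 0) \<and>
         (INF (\<eta>, i)\<in>UNIV. kappa_plus c \<eta> i + kappa_minus c \<eta> i) \<ge> \<kappa>"
proof -
  have c: "0 \<le> c x \<sigma>" for x \<sigma>
    unfolding c_def by (cases \<sigma>) auto
  have Dec: "c x (Dec i) = 0" if "x $ i = 0" for x i
    using that by (simp add: c_def)
  \<comment> \<open>Positive-rate moves can then be told apart by their targets, as the first-order
    expansion requires: only a decrease at coordinate 0 is blocked, and it has rate 0.\<close>
  have eff: "c x \<sigma> = 0" if "act \<sigma> x = x" for x \<sigma>
  proof (cases \<sigma>)
    case (Inc i)
    then show ?thesis using that act_Inc_neq[of i x] by simp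
  next
    case (Dec i)
    have "x $ i = 0"
    proof (rule ccontr)
      assume "x $ i \<noteq> 0"
      then show False using state_total_act_Dec[of x i] that Dec by simp
    qed
    then show ?thesis using \<open>\<And>x i. x $ i = 0 \<Longrightarrow> c x (Dec i) = 0\<close> Dec by simp
  qed
  obtain b where b: "\<And>v. v \<in> range (\<lambda>(\<eta>, i). grad (Inc i) Vp \<eta>) \<Longrightarrow> b \<le> v"
    using Vp_bound unfolding bdd_below_def by blast
  \<comment> \<open>The uniform lower bound on the gradients bounds all increasing rates at once,
    which is what keeps the pair chain from exploding.\<close>
  have Inc: "c x (Inc i) \<le> exp (- b)" for x i
    using b[OF rangeI, of "(x, i)"] by (simp add: c_def)
  have k0: "0 \<le> \<kappa>" using kappa_pos by simp
  have Inc_Dec: "act (Dec i) (act (Inc i) x) = x" for i x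
    using act_inv_move[OF act_Inc_neq, of i x] by simp
  show ?thesis
  proof
    assume contr: "\<forall>p::real. p \<ge> 1 \<longrightarrow>
            (\<forall>\<mu>\<in>finite_moment_laws p. \<forall>\<nu>\<in>finite_moment_laws p. \<forall>t>0.
               wasserstein p (law_at c \<mu> t) (law_at c \<nu> t)
                 \<le> ennreal (exp (- (\<kappa> / p) * t)) * wasserstein p \<mu> \<nu>)"
    \<comment> \<open>Point masses are admissible initial laws, and the converse tests the
      contraction on them alone.\<close>
    have "return_pmf x \<in> finite_moment_laws p" for x :: "'d state" and p
      by (simp add: finite_moment_laws_def)
    then have contr': "wasserstein p (law_at c (return_pmf x) t) (law_at c (return_pmf y) t) \<le>
        ennreal (exp (- (\<kappa> / p) * t)) * wasserstein p (return_pmf x) (return_pmf y)"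
      if "1 \<le> p" "0 < t" for p t x y
      using contr that by blast
    have curv: "0 \<le> move_curvature c x \<sigma>"
      "\<kappa> \<le> move_curvature c x \<sigma> + move_curvature c (act \<sigma> x) (inv_move \<sigma>)"
      if "act \<sigma> x \<noteq> x" for x \<sigma>
      by (rule curvature_of_contraction[where c = c and m = m and \<kappa> = \<kappa>];
          (assumption | rule c Irr that contr' k0 | erule eff)+)+
    have plus: "0 \<le> kappa_plus c x i" for x i
      unfolding kappa_plus_eq by (rule curv(1)[OF act_Inc_neq])
    have minus: "0 \<le> kappa_minus c x i" for x i
      unfolding kappa_minus_eq by (rule curv(1)) (metis act_Inc_neq Inc_Dec)
    have "\<kappa> \<le> (INF (\<eta>, i)\<in>UNIV. kappa_plus c \<eta> i + kappa_minus c \<eta> i)"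
    proof (rule cINF_greatest)
      fix z :: "'d state \<times> 'd"
      show "\<kappa> \<le> (case z of (\<eta>, i) \<Rightarrow> kappa_plus c \<eta> i + kappa_minus c \<eta> i)"
        using curv(2)[OF act_Inc_neq[of "snd z" "fst z"]]
        by (simp add: kappa_plus_eq kappa_minus_eq case_prod_unfold del: act.simps)
    qed simp
    with plus minus show "(\<forall>\<eta> i. kappa_plus c \<eta> i \<ge> 0 \<and> kappa_minus c \<eta> i \<ge> 0) \<and>
         (INF (\<eta>, i)\<in>UNIV. kappa_plus c \<eta> i + kappa_minus c \<eta> i) \<ge> \<kappa>"
      by blast
  next
    assume ii: "(\<forall>\<eta> i. kappa_plus c \<eta> i \<ge> 0 \<and> kappa_minus c \<eta> i \<ge> 0) \<and>
         (INF (\<eta>, i)\<in>UNIV. kappa_plus c \<eta> i + kappa_minus c \<eta> i) \<ge> \<kappa>"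
    \<comment> \<open>A real \<open>INF\<close> bounds its members only if they are bounded below;
      the sign conditions provide the bound 0.\<close>
    have bdd: "bdd_below ((\<lambda>(\<eta>, i). kappa_plus c \<eta> i + kappa_minus c \<eta> i) ` UNIV)"
      using ii by (intro bdd_belowI[of _ 0]) auto
    have sum: "\<kappa> \<le> kappa_plus c x i + kappa_minus c x i" for x i
      using order_trans[OF conjunct2[OF ii] cINF_lower[OF bdd UNIV_I, of "(x, i)"]] by simp
    have plus: "0 \<le> move_curvature c x (Inc i)"
      and minus: "0 \<le> move_curvature c (act (Inc i) x) (Dec i)" for x i
      using ii unfolding kappa_plus_eq kappa_minus_eq by blast+
    have curv: "0 \<le> move_curvature c x \<sigma> \<and>
      \<kappa> \<le> move_curvature c x \<sigma> + move_curvature c (act \<sigma> x) (inv_move \<sigma>)"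
      if "act \<sigma> x \<noteq> x" for x \<sigma>
    proof (cases \<sigma>)
      case (Inc i)
      then show ?thesis
        using plus[of x i] sum[of x i] by (simp add: kappa_plus_eq kappa_minus_eq del: act.simps)
    next
      case (Dec i)
      \<comment> \<open>A decreasing move runs along the edge from \<open>y\<close> up to
        \<open>x\<close> in reverse, so the two curvatures of that edge appear in the opposite
        order.\<close>
      define y where "y = act (Dec i) x"
      have x: "x = act (Inc i) y"
        using act_inv_move[OF that] Dec by (simp add: y_def del: act.simps)
      have "act \<sigma> x = y" by (simp add: Dec y_def)
      then show ?thesis
        using minus[of i y] sum[of y i] unfolding kappa_plus_eq kappa_minus_eq x[symmetric]
        by (simp add: Dec)
    qed
    show "\<forall>p::real. p \<ge> 1 \<longrightarrow>
            (\<forall>\<mu>\<in>finite_moment_laws p. \<forall>\<nu>\<in>finite_moment_laws p. \<forall>t>0.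
               wasserstein p (law_at c \<mu> t) (law_at c \<nu> t)
                 \<le> ennreal (exp (- (\<kappa> / p) * t)) * wasserstein p \<mu> \<nu>)"
    proof (intro allI impI ballI)
      fix p t :: real and \<mu> \<nu> :: "'d state pmf"
      assume "1 \<le> p" "0 < t"
      then show "wasserstein p (law_at c \<mu> t) (law_at c \<nu> t)
          \<le> ennreal (exp (- (\<kappa> / p) * t)) * wasserstein p \<mu> \<nu>"
        by (intro wasserstein_contraction[where c = c and m = m and C = "exp (- b)"] c Irr Inc)
          (erule Dec | rule curv[THEN conjunct1] curv[THEN conjunct2] | assumption)+
    qed
  qed
qed

end
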